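(* Work in the discrete setting described in the context. For $0\le m\le M-1$ consider the following scheme: given $\vec X^m\in V_\partial^h$ and $\vec U^m$, find $\vec U^{m+1}\in\mathbb U^m$, $P^{m+1}\in\mathbb P^m$, $\vec X^{m+1}\in V_\partial^h$ and $\varkappa^{m+1}\in V^h$ such that for all $(\vec\chi,q,\zeta,\vec\eta)\in\mathbb U^m\times\mathbb P^m\times V^h\times V_\partial^h$: (i) $\tfrac12\Big[\big(\tfrac{\rho^m\vec U^{m+1}-I_0^m\rho^{m-1}I_2^m\vec U^m}{\Delta t},\vec\chi\,r\big)+\big(I_0^m\rho^{m-1}\tfrac{\vec U^{m+1}-I_2^m\vec U^m}{\Delta t},\vec\chi\,r\big)\Big]+\mathscr A(\rho^m,I_2^m\vec U^m;\vec U^{m+1},\vec\chi)+2\big(\mu^m\,\mathbb D_c(\vec U^{m+1}),\mathbb D_c(\vec\chi)\,r\big)+2\big(\mu^m r^{-1}[\vec U^{m+1}\cdot\vec e_1],[\vec\chi\cdot\vec e_1]\big)^\diamond-\big(P^{m+1},\nabla_c\cdot[r\vec\chi]\big)-\gamma\big\langle(\vec X^m\cdot\vec e_1)\,\varkappa^{m+1}\,\vec\nu^m,\vec\chi\,|\vec X^m_\alpha|\big\rangle=\big(\rho^m\vec g,\vec\chi\,r\big)$; (ii) $\big(\nabla_c\cdot[r\vec U^{m+1}],q\big)=0$; (iii) $\tfrac1{\Delta t}\big\langle(\vec X^m\cdot\vec e_1)(\vec X^{m+1}-\vec X^m),\zeta\,\vec\nu^m|\vec X^m_\alpha|\big\rangle-\big\langle(\vec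 X^m\cdot\vec e_1)\,\vec U^{m+1},\zeta\,\vec\nu^m|\vec X^m_\alpha|\big\rangle=0$; (iv) $\big\langle(\vec X^m\cdot\vec e_1)\,\varkappa^{m+1}\vec\nu^m,\vec\eta\,|\vec X^m_\alpha|\big\rangle+\big\langle\vec\eta\cdot\vec e_1,|\vec X^{m+1}_\alpha|\big\rangle+\big\langle(\vec X^m\cdot\vec e_1)\vec X^{m+1}_\alpha,\vec\eta_\alpha|\vec X^m_\alpha|^{-1}\big\rangle=0$. Let $(\vec U^{m+1},P^{m+1},\vec X^{m+1},\varkappa^{m+1})$ be a solution of (i)-(iv). Then for $m=0,\dots,M-1$ $$\tfrac1{2\pi}E(\rho^m,\vec U^{m+1},\vec X^{m+1})+2\Delta t\Big(\|\sqrt{\mu^m r}\,\mathbb D_c(\vec U^{m+1})\|^2+\|\sqrt{\mu^m r^{-1}}\,[\vec U^{m+1}\cdot\vec e_1]\|_\diamond^2\Big)\le\tfrac1{2\pi}E(I_0^m\rho^{m-1},I_2^m\vec U^m,\vec X^m)+\Delta t\,\big(\rho^m r\,\vec g,\vec U^{m+1}\big).$$ Moreover, if in addition $$E(I_0^m\rho^{m-1},I_2^m\vec U^m,\vec X^m)\le E(\rho^{m-1},\vec U^m,\vec X^m)\quad\text{for } m=0,\dots,M-1,$$ then for $k=0,\dots,M-1$ $$\tfrac1{2\pi}E(\rho^k,\vec U^{k+1},\vec X^{k+1})+2\Delta t\sum_{m=0}^k\Big\{\|\sqrt{\mu^m r}\,\mathbb D_c(\vec U^{m+1})\|^2+\|\sqrt{\mu^m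 r^{-1}}\,[\vec U^{m+1}\cdot\vec e_1]\|_\diamond^2\Big\}\le\tfrac1{2\pi}E(\rho^0,\vec U^0,\vec X^0)+\Delta t\sum_{m=0}^k\big(\rho^m r\,\vec g,\vec U^{m+1}\big).$$
   Context: Domain. Points of the half-plane $\{r\ge0\}\subset\mathbb R^2$ are written $(r,z)$, with $\vec e_1=(1,0)^T$, $\vec e_2=(0,1)^T$. $\mathcal R\subset\{r>0\}$ is a bounded polygonal domain with boundary $\partial\mathcal R=\partial_1\mathcal R\cup\partial_2\mathcal R\cup\partial_z\mathcal R$, where $\partial_z\mathcal R$ is the part on the $z$-axis $\{r=0\}$; $\vec n$ is its outer unit normal. $\mathbb I=(0,1)$, $\partial\mathbb I=\{0,1\}$. $(\cdot,\cdot)$ and $\langle\cdot,\cdot\rangle$ are the $L^2$-inner products over $\mathcal R$ and $\mathbb I$ (for scalars, vectors, or matrices with the Frobenius product), and $\|\cdot\|$ is the norm induced by $(\cdot,\cdot)$. $\nabla_c=\vec e_1\partial_r+\vec e_2\partial_z$, $\mathbb D_c(\vec u)=\frac12[\nabla_c\vec u+(\nabla_c\vec u)^T]$, and $\mathscr A(\rho,\vec v;\vec u,\vec\chi)=\frac12\big(\rho\,r,[\vec v\cdot\nabla_c]\vec u\cdot\vec\chi-[\vec v\cdot\nabla_c]\vec\chi\cdot\vec u\big)$. Constants $\rho_\pm,\mu_\pm,\gamma>0$ and a body acceleration $\vec g$ with values in $\mathbb R^2$ (e.g. constant) are given. Spaces. $L^2_a(\mathcal R)=\{\chi:\int_{\mathcal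 R}r^a\chi^2\,dr\,dz<\infty\}$; $H^1_a(\mathcal R)=\{\chi\in L^2_a:\partial_r\chi,\partial_z\chi\in L^2_a\}$. $\mathbb U=\{\vec\chi\in[H^1_1(\mathcal R)]^2:\vec\chi\cdot\vec e_1\in L^2_{-1}(\mathcal R),\ \vec\chi=\vec0\text{ on }\partial_1\mathcal R,\ \vec\chi\cdot\vec n=0\text{ on }\partial_2\mathcal R\}$; $\mathbb P=\{\chi\in L^2_1(\mathcal R):\int_{\mathcal R}r\chi\,dr\,dz=0\}$; $V_\partial=\{\vec\eta\in[H^1(\mathbb I)]^2:\vec\eta\cdot\vec e_1=0\text{ on }\partial\mathbb I\}$. Discretization. $\Delta t=T/M$, $t_m=m\Delta t$. With $h=1/J_\Gamma$, $\alpha_j=jh$, $\mathbb I_j=[\alpha_{j-1},\alpha_j]$, $V^h$ is the space of continuous functions on $\overline{\mathbb I}$ that are affine on each $\mathbb I_j$, $1\le j\le J_\Gamma$, and $V^h_\partial=[V^h]^2\cap V_\partial$. Curves: $\vec X^m\in V^h_\partial$, $\Gamma^m=\vec X^m(\overline{\mathbb I})$, with standing assumption $\vec X^m\cdot\vec e_1>0$ in $\mathbb I$ and $|\vec X^m_\alpha|>0$ in $\mathbb I$ for $0\le m\le M$ (subscript $\alpha$ is differentiation in $\alpha$). $\vec\tau^m=\vec X^m_\alpha/|\vec X^m_\alpha|$, $\vec\nu^m=-(\vec\tau^m)^\perp$, where $\perp$ is clockwise rotation by $\pi/2$. $\Gamma^m$ divides $\mathcal R$ into $\mathcal R^m_-$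 (enclosed by $\Gamma^m$ and $\partial_z\mathcal R$) and $\mathcal R^m_+$, and $\vec\nu^m$ points into $\mathcal R^m_+$. In integrals over $\mathbb I$, bulk functions such as $\vec U^{m+1}$, $\vec\chi$ are evaluated at $\vec X^m(\alpha)$. For each $m$, $\mathscr T^m$ is a regular partition of $\overline{\mathcal R}$ into finitely many disjoint non-degenerate open triangles (not necessarily fitted to $\Gamma^m$). $S^m_k$ ($k\ge1$): continuous functions on $\overline{\mathcal R}$ that are polynomials of degree $\le k$ on each triangle; $S^m_0$: piecewise constants. $\mathbb U^m=[S^m_2]^2\cap\mathbb U$. $\mathbb P^m$ is either $S_1^m\cap\mathbb P$, or this space enriched by the single function $1_{\mathcal R^m_-}-\omega^m$, $\omega^m=\int_{\mathcal R^m_-}r\,dr\,dz/\int_{\mathcal R}r\,dr\,dz$ ($1_A$ is the characteristic function of $A$); in either case $\mathbb P^m\subset\mathbb P$. $I_2^m:[C(\overline{\mathcal R})]^2\to[S_2^m]^2$ is standard Lagrange interpolation; $I_0^m:L^1(\mathcal R)\to S^m_0$ is $(I_0^m\eta)|_o=|o|^{-1}\int_o\eta\,dr\,dz$. $\rho^m,\mu^m\in S_0^m$ equal $\rho_\pm,\mu_\pm$ on triangles contained in $\mathcal R^m_\pm$, and $\frac12(\rho_-+\rho_+)$, $\frac12(\mu_-+\mu_+)$ on triangles meeting $\Gamma^m$. Set $\rho^{-1}=\rho^0$. Initial data: $\vec U^0\in\mathbb U^0$, $\vec X^0\in V^h_\partial$; for $m\ge1$, $\vec U^m\in\mathbb U^{m-1}$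 is the velocity computed at the previous step. $(\cdot,\cdot)^\diamond$ is an approximation of $(\cdot,\cdot)$ by an elementwise quadrature rule with nonnegative weights and only interior sampling points (so that terms with $r^{-1}$ are well defined), and $\|\cdot\|_\diamond$ is its induced (semi)norm. Energy: $E(\rho,\vec u,\vec X)=\pi(\rho|\vec u|^2,r)+2\pi\gamma\langle\vec X\cdot\vec e_1,|\vec X_\alpha|\rangle$. *)

theory Defs
  imports "HOL-Analysis.Analysis"
begin

text \<open>
  A point \<open>x :: real^2\<close> of the meridian half-plane has the coordinates \<open>r = x $ 1\<close> and
  \<open>z = x $ 2\<close>; \<open>v $ 1\<close> and \<open>v $ 2\<close> are the products of \<open>v\<close> with the two unit vectors.
  Functions on the closure of the domain (on \<open>[0,1]\<close>) are total functions whose values elsewhere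
  are never used. All integrals are with respect to the completed measure \<^term>\<open>lebesgue\<close>, so
  values on null sets (such as edges of triangles, or nodes of a polygonal curve) do not matter.
\<close>

section \<open>Inner products\<close>

text \<open>The inner product on \<open>real^2^2\<close> is the Frobenius product.\<close>

definition l2_inner ::
  "'a::euclidean_space set \<Rightarrow> ('a \<Rightarrow> 'b::real_inner) \<Rightarrow> ('a \<Rightarrow> 'b) \<Rightarrow> real" where
  "l2_inner \<Omega> f g = set_lebesgue_integral lebesgue \<Omega> (\<lambda>x. f x \<bullet> g x)"

definition l2_norm :: "'a::euclidean_space set \<Rightarrow> ('a \<Rightarrow> 'b::real_inner) \<Rightarrow> real" where
  "l2_norm \<Omega> f = sqrt (l2_inner \<Omega> f f)"

abbreviation I_inner :: "(real \<Rightarrow> 'b::real_inner) \<Rightarrow> (real \<Rightarrow> 'b) \<Rightarrow> real" where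
  "I_inner \<equiv> l2_inner {0<..<1}"

section \<open>Weak derivatives and weighted Sobolev spaces\<close>

text \<open>Infinitely differentiable functions: the largest class of differentiable functions that is
  closed under partial derivatives.\<close>

coinductive smooth :: "('a::euclidean_space \<Rightarrow> real) \<Rightarrow> bool" where
  "(\<forall>x. \<phi> differentiable (at x)) \<Longrightarrow>
   (\<forall>b\<in>Basis. smooth (\<lambda>x. frechet_derivative \<phi> (at x) b)) \<Longrightarrow> smooth \<phi>"

definition test_function :: "'a::euclidean_space set \<Rightarrow> ('a \<Rightarrow> real) \<Rightarrow> bool" where
  "test_function \<Omega> \<phi> \<longleftrightarrow> smooth \<phi> \<and> (\<exists>K. compact K \<and> K \<subseteq> \<Omega> \<and> (\<forall>x. x \<notin> K \<longrightarrow> \<phi> x = 0))"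

definition locally_integrable :: "'a::euclidean_space set \<Rightarrow> ('a \<Rightarrow> real) \<Rightarrow> bool" where
  "locally_integrable \<Omega> f \<longleftrightarrow> (\<forall>K. compact K \<and> K \<subseteq> \<Omega> \<longrightarrow> set_integrable lebesgue K f)"

definition weak_derivative ::
  "'a::euclidean_space set \<Rightarrow> 'a \<Rightarrow> ('a \<Rightarrow> real) \<Rightarrow> ('a \<Rightarrow> real) \<Rightarrow> bool" where
  "weak_derivative \<Omega> b f g \<longleftrightarrow>
     locally_integrable \<Omega> f \<and> locally_integrable \<Omega> g \<and>
     (\<forall>\<phi>. test_function \<Omega> \<phi> \<longrightarrow>
        l2_inner \<Omega> f (\<lambda>x. frechet_derivative \<phi> (at x) b) = - l2_inner \<Omega> g \<phi>)"

definition L2_weighted ::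
  "'a::euclidean_space set \<Rightarrow> ('a \<Rightarrow> real) \<Rightarrow> ('a \<Rightarrow> real) set" where
  "L2_weighted \<Omega> w = {f. set_borel_measurable lebesgue \<Omega> f \<and>
                         set_integrable lebesgue \<Omega> (\<lambda>x. w x * (f x)\<^sup>2)}"

definition H1_weighted ::
  "'a::euclidean_space set \<Rightarrow> ('a \<Rightarrow> real) \<Rightarrow> ('a \<Rightarrow> real) set" where
  "H1_weighted \<Omega> w = {f \<in> L2_weighted \<Omega> w.
                         \<forall>b\<in>Basis. \<exists>g \<in> L2_weighted \<Omega> w. weak_derivative \<Omega> b f g}"

abbreviation L2r :: "real \<Rightarrow> (real^2) set \<Rightarrow> (real^2 \<Rightarrow> real) set" where
  "L2r a R \<equiv> L2_weighted R (\<lambda>x. (x $ 1) powr a)"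

abbreviation H1r :: "real \<Rightarrow> (real^2) set \<Rightarrow> (real^2 \<Rightarrow> real) set" where
  "H1r a R \<equiv> H1_weighted R (\<lambda>x. (x $ 1) powr a)"

section \<open>The domain and the continuous spaces\<close>

text \<open>The condition \<open>interior (closure R) = R\<close> excludes slits, so that an outer normal makes sense.\<close>

definition polygonal_domain :: "(real^2) set \<Rightarrow> bool" where
  "polygonal_domain R \<longleftrightarrow>
     open R \<and> connected R \<and> bounded R \<and> R \<noteq> {} \<and> interior (closure R) = R \<and>
     (\<exists>S. finite S \<and> frontier R = (\<Union>(a, b)\<in>S. closed_segment a b))"

definition axis_boundary :: "(real^2) set \<Rightarrow> (real^2) set" where
  "axis_boundary R = {x \<in> frontier R. x $ 1 = 0}"

text \<open>There is such an \<open>n\<close>, and then only one, exactly at the points of the boundary of a polygonal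
  domain that are not vertices.\<close>

definition outer_normal :: "(real^2) set \<Rightarrow> real^2 \<Rightarrow> real^2 \<Rightarrow> bool" where
  "outer_normal R x n \<longleftrightarrow> norm n = 1 \<and>
     (\<exists>\<epsilon>>0. R \<inter> ball x \<epsilon> = {y \<in> ball x \<epsilon>. (y - x) \<bullet> n < 0})"

text \<open>Boundary traces are taken as limits of averages; for a Sobolev function this determines the
  trace at almost every boundary point with respect to arc length, and for a function that is
  continuous on the closure it gives the value at the point. On a polygonal boundary, the sets of
  arc length zero are those that meet every segment in a linear null set.\<close>

definition zero_trace_at ::
  "(real^2) set \<Rightarrow> (real^2 \<Rightarrow> 'b::real_normed_vector) \<Rightarrow> real^2 \<Rightarrow> bool" where
  "zero_trace_at R f x \<longleftrightarrow>
     ((\<lambda>\<epsilon>. (\<integral>\<^sup>+ y. ennreal (norm (f y)) * indicator (R \<inter> ball x \<epsilon>) y \<partial>lebesgue)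
            / emeasure lebesgue (R \<inter> ball x \<epsilon>)) \<longlongrightarrow> 0) (at_right 0)"

definition AE_on_boundary :: "(real^2) set \<Rightarrow> (real^2 \<Rightarrow> bool) \<Rightarrow> bool" where
  "AE_on_boundary B Q \<longleftrightarrow>
     (\<forall>a b. a \<noteq> b \<longrightarrow> negligible {t \<in> {0..1::real}. (let x = a + t *\<^sub>R (b - a) in x \<in> B \<and> \<not> Q x)})"

definition U_space ::
  "(real^2) set \<Rightarrow> (real^2) set \<Rightarrow> (real^2) set \<Rightarrow> (real^2 \<Rightarrow> real^2) set" where
  "U_space R B1 B2 = {v.
     (\<forall>i. (\<lambda>x. v x $ i) \<in> H1r 1 R) \<and> (\<lambda>x. v x $ 1) \<in> L2r (-1) R \<and>
     AE_on_boundary B1 (zero_trace_at R v) \<and>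
     AE_on_boundary B2 (\<lambda>x. \<forall>n. outer_normal R x n \<longrightarrow> zero_trace_at R (\<lambda>y. v y \<bullet> n) x)}"

definition P_space :: "(real^2) set \<Rightarrow> (real^2 \<Rightarrow> real) set" where
  "P_space R = {q \<in> L2r 1 R. set_lebesgue_integral lebesgue R (\<lambda>x. x $ 1 * q x) = 0}"

text \<open>Elements of \<open>H\<^sup>1\<close> of the interval are represented by their continuous versions, so
  that they have values at the end points.\<close>

definition V_bdry :: "(real \<Rightarrow> real^2) set" where
  "V_bdry = {\<eta>. continuous_on {0..1} \<eta> \<and>
     (\<forall>i. (\<lambda>\<alpha>. \<eta> \<alpha> $ i) \<in> H1_weighted {0<..<1} (\<lambda>_. 1)) \<and> \<eta> 0 $ 1 = 0 \<and> \<eta> 1 $ 1 = 0}"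

section \<open>Parametric curves\<close>

definition Vh :: "nat \<Rightarrow> (real \<Rightarrow> 'b::real_normed_vector) set" where
  "Vh J = {f. continuous_on {0..1} f \<and>
     (\<forall>j\<in>{1..J}. \<exists>a b. \<forall>\<alpha>\<in>{(real j - 1) / real J .. real j / real J}. f \<alpha> = a + \<alpha> *\<^sub>R b)}"

definition Vh_bdry :: "nat \<Rightarrow> (real \<Rightarrow> real^2) set" where
  "Vh_bdry J = Vh J \<inter> V_bdry"

definition nodes_I :: "nat \<Rightarrow> real set" where
  "nodes_I J = {real j / real J | j. j \<le> J}"

definition D\<alpha> :: "(real \<Rightarrow> real^2) \<Rightarrow> real \<Rightarrow> real^2" where
  "D\<alpha> X \<alpha> = vector_derivative X (at \<alpha>)"

text \<open>Clockwise rotation by \<open>\<pi>/2\<close>.\<close>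

definition perp :: "real^2 \<Rightarrow> real^2" where
  "perp v = vector [v $ 2, - (v $ 1)]"

definition tangent :: "(real \<Rightarrow> real^2) \<Rightarrow> real \<Rightarrow> real^2" where
  "tangent X \<alpha> = D\<alpha> X \<alpha> /\<^sub>R norm (D\<alpha> X \<alpha>)"

definition normal :: "(real \<Rightarrow> real^2) \<Rightarrow> real \<Rightarrow> real^2" where
  "normal X \<alpha> = - perp (tangent X \<alpha>)"

definition inner_phase :: "(real^2) set \<Rightarrow> (real \<Rightarrow> real^2) \<Rightarrow> (real^2) set" where
  "inner_phase R X = R \<inter> inside (X ` {0..1} \<union> axis_boundary R)"

definition outer_phase :: "(real^2) set \<Rightarrow> (real \<Rightarrow> real^2) \<Rightarrow> (real^2) set" where
  "outer_phase R X = R - (X ` {0..1} \<union> inner_phase R X)"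

text \<open>The curve lies in the closure of the domain and separates the two phases, with the normal
  pointing out of the inner and into the outer phase.\<close>

definition divides_domain :: "(real^2) set \<Rightarrow> nat \<Rightarrow> (real \<Rightarrow> real^2) \<Rightarrow> bool" where
  "divides_domain R J X \<longleftrightarrow> X ` {0..1} \<subseteq> closure R \<and>
     (\<forall>\<alpha>\<in>{0<..<1} - nodes_I J. \<forall>\<^sub>F \<epsilon> in at_right 0.
        X \<alpha> + \<epsilon> *\<^sub>R normal X \<alpha> \<in> outer_phase R X \<and>
        X \<alpha> - \<epsilon> *\<^sub>R normal X \<alpha> \<in> inner_phase R X)"

text \<open>The derivative of a piecewise affine curve exists away from the nodes only.\<close>

definition regular_curve :: "nat \<Rightarrow> (real \<Rightarrow> real^2) \<Rightarrow> bool" where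
  "regular_curve J X \<longleftrightarrow> (\<forall>\<alpha>\<in>{0<..<1}. X \<alpha> $ 1 > 0) \<and>
     (\<forall>\<alpha>\<in>{0<..<1} - nodes_I J. norm (D\<alpha> X \<alpha>) > 0)"

section \<open>Finite elements\<close>

definition open_triangle :: "(real^2) set \<Rightarrow> bool" where
  "open_triangle k \<longleftrightarrow> (\<exists>a b c. \<not> collinear {a, b, c} \<and> k = interior (convex hull {a, b, c}))"

definition regular_partition :: "(real^2) set \<Rightarrow> (real^2) set set \<Rightarrow> bool" where
  "regular_partition R T \<longleftrightarrow>
     finite T \<and> (\<forall>k\<in>T. open_triangle k) \<and> disjoint T \<and> (\<Union>k\<in>T. closure k) = closure R \<and>
     (\<forall>k\<in>T. \<forall>l\<in>T. (closure k \<inter> closure l) face_of closure k)"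

definition polynomial2_on :: "nat \<Rightarrow> (real^2) set \<Rightarrow> (real^2 \<Rightarrow> real) \<Rightarrow> bool" where
  "polynomial2_on d S f \<longleftrightarrow>
     (\<exists>c. \<forall>x\<in>S. f x = (\<Sum>i\<le>d. \<Sum>j\<le>d - i. c i j * (x $ 1) ^ i * (x $ 2) ^ j))"

definition S_space :: "nat \<Rightarrow> (real^2) set \<Rightarrow> (real^2) set set \<Rightarrow> (real^2 \<Rightarrow> real) set" where
  "S_space d R T = {f. continuous_on (closure R) f \<and> (\<forall>k\<in>T. polynomial2_on d k f)}"

definition S_vec_space ::
  "nat \<Rightarrow> (real^2) set \<Rightarrow> (real^2) set set \<Rightarrow> (real^2 \<Rightarrow> real^2) set" where
  "S_vec_space d R T = {v. \<forall>i. (\<lambda>x. v x $ i) \<in> S_space d R T}"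

definition Uh_space ::
  "(real^2) set \<Rightarrow> (real^2) set \<Rightarrow> (real^2) set \<Rightarrow> (real^2) set set \<Rightarrow> (real^2 \<Rightarrow> real^2) set" where
  "Uh_space R B1 B2 T = S_vec_space 2 R T \<inter> U_space R B1 B2"

definition Ph_space :: "(real^2) set \<Rightarrow> (real^2) set set \<Rightarrow> (real^2 \<Rightarrow> real) set" where
  "Ph_space R T = S_space 1 R T \<inter> P_space R"

definition Ph_enriched ::
  "(real^2) set \<Rightarrow> (real^2) set set \<Rightarrow> (real \<Rightarrow> real^2) \<Rightarrow> (real^2 \<Rightarrow> real) set" where
  "Ph_enriched R T X =
     (let A = inner_phase R X;
          \<omega> = set_lebesgue_integral lebesgue A (\<lambda>x. x $ 1)
                / set_lebesgue_integral lebesgue R (\<lambda>x. x $ 1)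
      in {(\<lambda>x. q x + c * (indicator A x - \<omega>)) | q c. q \<in> Ph_space R T})"

text \<open>Vertices (the case \<open>p = q\<close>) and midpoints of edges.\<close>

definition P2_nodes :: "(real^2) set set \<Rightarrow> (real^2) set" where
  "P2_nodes T = {midpoint p q | p q k. k \<in> T \<and>
                   p extreme_point_of closure k \<and> q extreme_point_of closure k}"

text \<open>The interpolant is unique on the closure of the domain.\<close>

definition I2 ::
  "(real^2) set \<Rightarrow> (real^2) set set \<Rightarrow> (real^2 \<Rightarrow> real^2) \<Rightarrow> (real^2 \<Rightarrow> real^2)" where
  "I2 R T f = (SOME v. v \<in> S_vec_space 2 R T \<and> (\<forall>p\<in>P2_nodes T. v p = f p))"

text \<open>Piecewise constants are given the value zero on the edges.\<close>

definition I0 :: "(real^2) set set \<Rightarrow> (real^2 \<Rightarrow> real) \<Rightarrow> real^2 \<Rightarrow> real" where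
  "I0 T f x = (\<Sum>k\<in>T. indicator k x * (set_lebesgue_integral lebesgue k f / measure lebesgue k))"

definition phase_coeff ::
  "(real^2) set \<Rightarrow> (real^2) set set \<Rightarrow> (real \<Rightarrow> real^2) \<Rightarrow> real \<Rightarrow> real \<Rightarrow> real^2 \<Rightarrow> real" where
  "phase_coeff R T X cm cp x =
     (\<Sum>k\<in>T. indicator k x *
        (if k \<inter> X ` {0..1} \<noteq> {} then (cm + cp) / 2
         else if k \<subseteq> inner_phase R X then cm else cp))"

text \<open>An elementwise quadrature rule: finitely many sampling points in each open triangle.\<close>

definition interior_quadrature ::
  "(real^2) set set \<Rightarrow> ((real^2) set \<Rightarrow> (real^2) set) \<Rightarrow> ((real^2) set \<Rightarrow> real^2 \<Rightarrow> real) \<Rightarrow> bool" where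
  "interior_quadrature T pts wt \<longleftrightarrow>
     (\<forall>k\<in>T. finite (pts k) \<and> pts k \<subseteq> k \<and> (\<forall>p\<in>pts k. wt k p \<ge> 0))"

definition quad_inner ::
  "(real^2) set set \<Rightarrow> ((real^2) set \<Rightarrow> (real^2) set) \<Rightarrow> ((real^2) set \<Rightarrow> real^2 \<Rightarrow> real) \<Rightarrow>
   (real^2 \<Rightarrow> real) \<Rightarrow> (real^2 \<Rightarrow> real) \<Rightarrow> real" where
  "quad_inner T pts wt f g = (\<Sum>k\<in>T. \<Sum>p\<in>pts k. wt k p * (f p * g p))"

definition quad_norm ::
  "(real^2) set set \<Rightarrow> ((real^2) set \<Rightarrow> (real^2) set) \<Rightarrow> ((real^2) set \<Rightarrow> real^2 \<Rightarrow> real) \<Rightarrow>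
   (real^2 \<Rightarrow> real) \<Rightarrow> real" where
  "quad_norm T pts wt f = sqrt (quad_inner T pts wt f f)"

section \<open>Differential operators\<close>

text \<open>These are applied to continuous piecewise polynomials, whose weak derivatives agree almost
  everywhere with the classical derivatives inside the triangles.\<close>

definition pd :: "2 \<Rightarrow> (real^2 \<Rightarrow> real) \<Rightarrow> real^2 \<Rightarrow> real" where
  "pd i f x = frechet_derivative f (at x) (axis i 1)"

definition grad_c :: "(real^2 \<Rightarrow> real^2) \<Rightarrow> real^2 \<Rightarrow> real^2^2" where
  "grad_c v x = (\<chi> i j. pd j (\<lambda>y. v y $ i) x)"

definition D_c :: "(real^2 \<Rightarrow> real^2) \<Rightarrow> real^2 \<Rightarrow> real^2^2" where
  "D_c v x = (1/2) *\<^sub>R (grad_c v x + transpose (grad_c v x))"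

definition div_c :: "(real^2 \<Rightarrow> real^2) \<Rightarrow> real^2 \<Rightarrow> real" where
  "div_c v x = pd 1 (\<lambda>y. v y $ 1) x + pd 2 (\<lambda>y. v y $ 2) x"

definition advect :: "(real^2 \<Rightarrow> real^2) \<Rightarrow> (real^2 \<Rightarrow> real^2) \<Rightarrow> real^2 \<Rightarrow> real^2" where
  "advect w v x = (\<chi> i. w x $ 1 * pd 1 (\<lambda>y. v y $ i) x + w x $ 2 * pd 2 (\<lambda>y. v y $ i) x)"

definition A_form :: "(real^2) set \<Rightarrow> (real^2 \<Rightarrow> real) \<Rightarrow> (real^2 \<Rightarrow> real^2) \<Rightarrow>
    (real^2 \<Rightarrow> real^2) \<Rightarrow> (real^2 \<Rightarrow> real^2) \<Rightarrow> real" where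
  "A_form R \<rho> w u v = (1/2) * l2_inner R (\<lambda>x. \<rho> x * x $ 1)
                                  (\<lambda>x. advect w u x \<bullet> v x - advect w v x \<bullet> u x)"

section \<open>The energy and the scheme\<close>

definition energy :: "(real^2) set \<Rightarrow> real \<Rightarrow> (real^2 \<Rightarrow> real) \<Rightarrow> (real^2 \<Rightarrow> real^2) \<Rightarrow>
    (real \<Rightarrow> real^2) \<Rightarrow> real" where
  "energy R \<gamma> \<rho> u X =
     pi * l2_inner R (\<lambda>x. \<rho> x * (norm (u x))\<^sup>2) (\<lambda>x. x $ 1)
     + 2 * pi * \<gamma> * I_inner (\<lambda>\<alpha>. X \<alpha> $ 1) (\<lambda>\<alpha>. norm (D\<alpha> X \<alpha>))"

text \<open>In the following, \<open>\<rho>0\<close> and \<open>u0\<close> stand for the interpolated density and velocity of the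
  previous step, \<open>X0\<close> for the given curve, and \<open>u\<close>, \<open>p\<close>, \<open>X\<close>, \<open>\<kappa>\<close> for the unknowns.\<close>

definition momentum_eq ::
  "(real^2) set \<Rightarrow> (real^2) set set \<Rightarrow>
   ((real^2) set \<Rightarrow> (real^2) set) \<Rightarrow> ((real^2) set \<Rightarrow> real^2 \<Rightarrow> real) \<Rightarrow>
   real \<Rightarrow> real \<Rightarrow> (real^2 \<Rightarrow> real^2) \<Rightarrow>
   (real^2 \<Rightarrow> real) \<Rightarrow> (real^2 \<Rightarrow> real) \<Rightarrow> (real^2 \<Rightarrow> real) \<Rightarrow>
   (real^2 \<Rightarrow> real^2) \<Rightarrow> (real \<Rightarrow> real^2) \<Rightarrow>
   (real^2 \<Rightarrow> real^2) \<Rightarrow> (real^2 \<Rightarrow> real) \<Rightarrow> (real \<Rightarrow> real) \<Rightarrow>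
   (real^2 \<Rightarrow> real^2) \<Rightarrow> bool" where
  "momentum_eq R T pts wt \<gamma> dt g \<rho>0 \<rho> \<mu> u0 X0 u p \<kappa> v \<longleftrightarrow>
     (1/2) * (l2_inner R (\<lambda>x. (\<rho> x *\<^sub>R u x - \<rho>0 x *\<^sub>R u0 x) /\<^sub>R dt) (\<lambda>x. x $ 1 *\<^sub>R v x)
              + l2_inner R (\<lambda>x. \<rho>0 x *\<^sub>R ((u x - u0 x) /\<^sub>R dt)) (\<lambda>x. x $ 1 *\<^sub>R v x))
     + A_form R \<rho> u0 u v
     + 2 * l2_inner R (\<lambda>x. \<mu> x *\<^sub>R D_c u x) (\<lambda>x. x $ 1 *\<^sub>R D_c v x)
     + 2 * quad_inner T pts wt (\<lambda>x. \<mu> x * inverse (x $ 1) * (u x $ 1)) (\<lambda>x. v x $ 1)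
     - l2_inner R p (div_c (\<lambda>x. x $ 1 *\<^sub>R v x))
     - \<gamma> * I_inner (\<lambda>\<alpha>. (X0 \<alpha> $ 1 * \<kappa> \<alpha>) *\<^sub>R normal X0 \<alpha>) (\<lambda>\<alpha>. norm (D\<alpha> X0 \<alpha>) *\<^sub>R v (X0 \<alpha>))
     = l2_inner R (\<lambda>x. \<rho> x *\<^sub>R g x) (\<lambda>x. x $ 1 *\<^sub>R v x)"

definition incompressibility_eq ::
  "(real^2) set \<Rightarrow> (real^2 \<Rightarrow> real^2) \<Rightarrow> (real^2 \<Rightarrow> real) \<Rightarrow> bool" where
  "incompressibility_eq R u q \<longleftrightarrow> l2_inner R (div_c (\<lambda>x. x $ 1 *\<^sub>R u x)) q = 0"

definition kinematic_eq ::
  "real \<Rightarrow> (real \<Rightarrow> real^2) \<Rightarrow> (real^2 \<Rightarrow> real^2) \<Rightarrow> (real \<Rightarrow> real^2) \<Rightarrow> (real \<Rightarrow> real) \<Rightarrow> bool" where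
  "kinematic_eq dt X0 u X \<zeta> \<longleftrightarrow>
     (1 / dt) * I_inner (\<lambda>\<alpha>. X0 \<alpha> $ 1 *\<^sub>R (X \<alpha> - X0 \<alpha>))
                        (\<lambda>\<alpha>. (\<zeta> \<alpha> * norm (D\<alpha> X0 \<alpha>)) *\<^sub>R normal X0 \<alpha>)
     - I_inner (\<lambda>\<alpha>. X0 \<alpha> $ 1 *\<^sub>R u (X0 \<alpha>))
               (\<lambda>\<alpha>. (\<zeta> \<alpha> * norm (D\<alpha> X0 \<alpha>)) *\<^sub>R normal X0 \<alpha>) = 0"

definition curvature_eq ::
  "(real \<Rightarrow> real^2) \<Rightarrow> (real \<Rightarrow> real^2) \<Rightarrow> (real \<Rightarrow> real) \<Rightarrow> (real \<Rightarrow> real^2) \<Rightarrow> bool" where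
  "curvature_eq X0 X \<kappa> \<eta> \<longleftrightarrow>
     I_inner (\<lambda>\<alpha>. (X0 \<alpha> $ 1 * \<kappa> \<alpha>) *\<^sub>R normal X0 \<alpha>) (\<lambda>\<alpha>. norm (D\<alpha> X0 \<alpha>) *\<^sub>R \<eta> \<alpha>)
     + I_inner (\<lambda>\<alpha>. \<eta> \<alpha> $ 1) (\<lambda>\<alpha>. norm (D\<alpha> X \<alpha>))
     + I_inner (\<lambda>\<alpha>. X0 \<alpha> $ 1 *\<^sub>R D\<alpha> X \<alpha>) (\<lambda>\<alpha>. inverse (norm (D\<alpha> X0 \<alpha>)) *\<^sub>R D\<alpha> \<eta> \<alpha>) = 0"

definition scheme_solution ::
  "(real^2) set \<Rightarrow> (real^2) set \<Rightarrow> (real^2) set \<Rightarrow> (real^2) set set \<Rightarrow> (real^2 \<Rightarrow> real) set \<Rightarrow> nat \<Rightarrow>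
   ((real^2) set \<Rightarrow> (real^2) set) \<Rightarrow> ((real^2) set \<Rightarrow> real^2 \<Rightarrow> real) \<Rightarrow>
   real \<Rightarrow> real \<Rightarrow> (real^2 \<Rightarrow> real^2) \<Rightarrow>
   (real^2 \<Rightarrow> real) \<Rightarrow> (real^2 \<Rightarrow> real) \<Rightarrow> (real^2 \<Rightarrow> real) \<Rightarrow>
   (real^2 \<Rightarrow> real^2) \<Rightarrow> (real \<Rightarrow> real^2) \<Rightarrow>
   (real^2 \<Rightarrow> real^2) \<Rightarrow> (real^2 \<Rightarrow> real) \<Rightarrow> (real \<Rightarrow> real^2) \<Rightarrow> (real \<Rightarrow> real) \<Rightarrow> bool" where
  "scheme_solution R B1 B2 T PP J pts wt \<gamma> dt g \<rho>0 \<rho> \<mu> u0 X0 u p X \<kappa> \<longleftrightarrow>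
     u \<in> Uh_space R B1 B2 T \<and> p \<in> PP \<and> X \<in> Vh_bdry J \<and> \<kappa> \<in> Vh J \<and>
     (\<forall>v\<in>Uh_space R B1 B2 T. momentum_eq R T pts wt \<gamma> dt g \<rho>0 \<rho> \<mu> u0 X0 u p \<kappa> v) \<and>
     (\<forall>q\<in>PP. incompressibility_eq R u q) \<and>
     (\<forall>\<zeta>\<in>Vh J. kinematic_eq dt X0 u X \<zeta>) \<and>
     (\<forall>\<eta>\<in>Vh_bdry J. curvature_eq X0 X \<kappa> \<eta>)"

definition dissipation ::
  "(real^2) set \<Rightarrow> (real^2) set set \<Rightarrow>
   ((real^2) set \<Rightarrow> (real^2) set) \<Rightarrow> ((real^2) set \<Rightarrow> real^2 \<Rightarrow> real) \<Rightarrow>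
   (real^2 \<Rightarrow> real) \<Rightarrow> (real^2 \<Rightarrow> real^2) \<Rightarrow> real" where
  "dissipation R T pts wt \<mu> u =
     (l2_norm R (\<lambda>x. sqrt (\<mu> x * x $ 1) *\<^sub>R D_c u x))\<^sup>2
     + (quad_norm T pts wt (\<lambda>x. sqrt (\<mu> x * inverse (x $ 1)) * (u x $ 1)))\<^sup>2"

end

theory Submission
  imports Defs
begin

text \<open>
  The scheme is tested with its own solution: \<open>v = U (Suc m)\<close> in the momentum equation,
  \<open>q = P (Suc m)\<close>, \<open>\<zeta> = \<kappa> (Suc m)\<close>, and \<open>\<eta> = X (Suc m) - X m\<close> in the curvature equation. The
  pressure and the advection drop out, and the curvature terms combine to the change of the surface
  energy, up to the convexity inequality \<open>norm v - norm w \<le> v \<bullet> (v - w) / norm w\<close>.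
  The kinetic energy uses \<open>(\<rho> u - \<rho>0 u0) \<bullet> u + \<rho>0 (u - u0) \<bullet> u = \<rho> |u|\<^sup>2 - \<rho>0 |u0|\<^sup>2 + \<rho>0 |u - u0|\<^sup>2\<close>.
  Splitting the integrals needs integrability, in particular that of the interpolated velocity, which
  is only known once the quadratic Lagrange interpolant has been shown to exist.
\<close>

section \<open>Quadratic Lagrange interpolation\<close>

text \<open>In barycentric coordinates \<open>w\<close> the Lagrange basis functions of a vertex \<open>p\<close> and of an edge midpoint
  are \<open>w p * (2 * w p - 1)\<close> and \<open>4 * w p * w q\<close>; as \<open>w\<close> has sum 1, the interpolant is this quadratic
  form, which is visibly the same on a common face of two triangles.\<close>

definition p2_form :: "(real^2 \<Rightarrow> real^2) \<Rightarrow> (real^2) set \<Rightarrow> (real^2 \<Rightarrow> real) \<Rightarrow> real^2" where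
  "p2_form f V w =
     (\<Sum>p\<in>V. \<Sum>q\<in>V. (w p * w q) *\<^sub>R (2 *\<^sub>R f (midpoint p q) - (1/2) *\<^sub>R (f p + f q)))"

text \<open>For a point on a face, the weights at the vertices off that face vanish, so the form
  only sees the vertices of the face. This is what makes neighbouring interpolants match.\<close>

lemma p2_form_mono_neutral:
  assumes "finite V" "S \<subseteq> V" "\<And>p. p \<in> V - S \<Longrightarrow> w p = 0"
  shows "p2_form f V w = p2_form f S w"
proof -
  have "p2_form f V w =
      (\<Sum>p\<in>S. \<Sum>q\<in>V. (w p * w q) *\<^sub>R (2 *\<^sub>R f (midpoint p q) - (1/2) *\<^sub>R (f p + f q)))"
    unfolding p2_form_def by (rule sum.mono_neutral_right) (use assms in auto)
  also have "\<dots> = p2_form f S w"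
    unfolding p2_form_def
    by (rule sum.cong[OF refl], rule sum.mono_neutral_right) (use assms in auto)
  finally show ?thesis .
qed

lemma p2_form_midpoint:
  assumes "finite V" "p \<in> V" "q \<in> V"
  obtains w where "sum w V = 1" "(\<Sum>x\<in>V. w x *\<^sub>R x) = midpoint p q"
    "p2_form f V w = f (midpoint p q)"
proof
  \<comment> \<open>Half the sum of two indicators: weight 1/2 at each end of an edge, and weight 1
    when \<open>p = q\<close>, so that edge midpoints and vertices are handled together.\<close>
  define w :: "real^2 \<Rightarrow> real" where "w = (\<lambda>x. ((if x = p then 1 else 0) + (if x = q then 1 else 0)) / 2)"
  show "sum w V = 1"
    using assms by (simp add: w_def sum.distrib sum.delta flip: sum_divide_distrib)
  have split: "(\<Sum>x\<in>V. w x *\<^sub>R h x) = (1/2) *\<^sub>R (h p + h q)" for h :: "real^2 \<Rightarrow> real^2"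
  proof -
    have "(\<Sum>x\<in>V. w x *\<^sub>R h x) =
        (\<Sum>x\<in>V. (if x = p then (1/2) *\<^sub>R h x else 0) + (if x = q then (1/2) *\<^sub>R h x else 0))"
      by (rule sum.cong) (auto simp: w_def scaleR_left_distrib[symmetric])
    then show ?thesis using assms by (simp add: sum.distrib sum.delta scaleR_right_distrib)
  qed
  show "(\<Sum>x\<in>V. w x *\<^sub>R x) = midpoint p q" by (simp add: split midpoint_def)
  show "p2_form f V w = f (midpoint p q)"
  proof -
    have "p2_form f V w =
        (\<Sum>x\<in>V. w x *\<^sub>R (\<Sum>y\<in>V. w y *\<^sub>R (2 *\<^sub>R f (midpoint x y) - (1/2) *\<^sub>R (f x + f y))))"
      by (simp add: p2_form_def scaleR_sum_right)
    \<comment> \<open>The diagonal terms give \<open>(f p + f q) / 4\<close>; the two mixed terms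
      give the midpoint value minus the same quantity.\<close>
    also have "\<dots> = f (midpoint p q)"
      unfolding split by (simp add: midpoint_sym[of q p] vec_eq_iff field_simps)
    finally show ?thesis .
  qed
qed

section \<open>Affine coordinates on a triangle\<close>

lemma det_nonzero_if_not_collinear:
  fixes a b c :: "real^2"
  assumes "\<not> collinear {a, b, c}"
  shows "(b $ 1 - a $ 1) * (c $ 2 - a $ 2) - (b $ 2 - a $ 2) * (c $ 1 - a $ 1) \<noteq> 0"
proof
  assume d: "(b $ 1 - a $ 1) * (c $ 2 - a $ 2) - (b $ 2 - a $ 2) * (c $ 1 - a $ 1) = 0"
  define x y where "x = b - a" and "y = c - a"
  have e: "x $ 1 * y $ 2 = x $ 2 * y $ 1" using d by (simp add: x_def y_def)
  \<comment> \<open>A vanishing determinant makes the two edge vectors parallel; the factor is a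
    quotient of coordinates, taken where \<open>x\<close> has a nonzero one.\<close>
  have "x \<noteq> 0 \<Longrightarrow> \<exists>t. y = t *\<^sub>R x"
  proof -
    assume "x \<noteq> 0"
    then consider "x $ 1 \<noteq> 0" | "x $ 2 \<noteq> 0" by (auto simp: vec_eq_iff forall_2)
    then show ?thesis
    proof cases
      case 1
      then show ?thesis using e
        by (intro exI[of _ "y $ 1 / x $ 1"]) (auto simp: vec_eq_iff forall_2 field_simps)
    next
      case 2
      then show ?thesis using e
        by (intro exI[of _ "y $ 2 / x $ 2"]) (auto simp: vec_eq_iff forall_2 field_simps)
    qed
  qed
  then have "collinear {0, x, y}" unfolding collinear_lemma by blast
  then have "collinear {b, a, c}"
    using collinear_3[of b a c] by (simp add: x_def y_def)
  then show False using assms by (simp add: insert_commute)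
qed

text \<open>A barycentric weight is an affine function of the point: its gradient is orthogonal to
  the opposite edge, and its constant term makes it vanish on that edge.\<close>

lemma barycentric_coordinate:
  fixes a b c :: "real^2"
  assumes "\<not> collinear {a, b, c}"
  obtains \<alpha> v where "\<And>w1 w2 w3. w1 + w2 + w3 = 1 \<Longrightarrow>
     \<alpha> + v \<bullet> (w1 *\<^sub>R a + w2 *\<^sub>R b + w3 *\<^sub>R c) = (w1::real)"
proof -
  have d: "(b $ 1 - a $ 1) * (c $ 2 - a $ 2) - (b $ 2 - a $ 2) * (c $ 1 - a $ 1) \<noteq> 0" (is "?D \<noteq> 0")
    using det_nonzero_if_not_collinear[OF assms] .
  \<comment> \<open>The edge vector \<open>c - b\<close> rotated by a right angle; dividing by twice
    the signed area makes the weight grow from 0 at \<open>c\<close> to 1 at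
    \<open>a\<close>.\<close>
  define v :: "real^2" where "v = vector [(b $ 2 - c $ 2) / ?D, (c $ 1 - b $ 1) / ?D]"
  have va: "v \<bullet> (a - c) = 1" and vb: "v \<bullet> (b - c) = 0"
    using d by (simp_all add: v_def inner_vec_def sum_2 divide_simps) (simp_all add: algebra_simps)
  show ?thesis
  proof
    fix w1 w2 w3 :: real assume "w1 + w2 + w3 = 1"
    then have w: "w3 = 1 - w1 - w2" by simp
    have "w1 *\<^sub>R a + w2 *\<^sub>R b + w3 *\<^sub>R c = w1 *\<^sub>R (a - c) + w2 *\<^sub>R (b - c) + c"
      by (simp add: w algebra_simps)
    then show "- (v \<bullet> c) + v \<bullet> (w1 *\<^sub>R a + w2 *\<^sub>R b + w3 *\<^sub>R c) = w1"
      by (simp add: inner_add_right va vb)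
  qed
qed

section \<open>Quadratic polynomials in the two coordinates\<close>

lemma polynomial2_on_2I:
  assumes "\<And>x. x \<in> S \<Longrightarrow> f x = c00 + c01 * x $ 2 + c02 * (x $ 2)\<^sup>2 + c10 * x $ 1
     + c11 * x $ 1 * x $ 2 + c20 * (x $ 1)\<^sup>2"
  shows "polynomial2_on 2 S f"
  unfolding polynomial2_on_def
  \<comment> \<open>Only indices with \<open>i + j \<le> 2\<close> enter the sum, so the last branch
    stands for the pair (2, 0) alone.\<close>
  by (rule exI[of _ "\<lambda>i j. if i = 0 then (if j = 0 then c00 else if j = 1 then c01 else c02)
        else if i = 1 then (if j = 0 then c10 else c11) else c20"])
     (auto simp: assms numeral_2_eq_2)

lemma polynomial2_on_zero: "polynomial2_on d S (\<lambda>_. 0)"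
  unfolding polynomial2_on_def by (rule exI[of _ "\<lambda>_ _. 0"]) simp

lemma polynomial2_on_add:
  assumes "polynomial2_on d S f" "polynomial2_on d S g"
  shows "polynomial2_on d S (\<lambda>x. f x + g x)"
proof -
  obtain a b where "\<forall>x\<in>S. f x = (\<Sum>i\<le>d. \<Sum>j\<le>d - i. a i j * (x $ 1) ^ i * (x $ 2) ^ j)"
    "\<forall>x\<in>S. g x = (\<Sum>i\<le>d. \<Sum>j\<le>d - i. b i j * (x $ 1) ^ i * (x $ 2) ^ j)"
    using assms unfolding polynomial2_on_def by blast
  then show ?thesis unfolding polynomial2_on_def
    by (intro exI[of _ "\<lambda>i j. a i j + b i j"]) (simp add: sum.distrib algebra_simps)
qed

lemma polynomial2_on_sum:
  assumes "\<And>i. i \<in> I \<Longrightarrow> polynomial2_on d S (f i)"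
  shows "polynomial2_on d S (\<lambda>x. \<Sum>i\<in>I. f i x)"
  using assms
  by (induction I rule: infinite_finite_induct)
     (auto intro: polynomial2_on_zero polynomial2_on_add)

text \<open>This is the shape of a component of one summand of \<open>p2_form\<close> once the
  weights are affine functions of the point.\<close>

lemma polynomial2_on_affine_mult:
  "polynomial2_on 2 S (\<lambda>x. (\<alpha> + v \<bullet> x) * (\<beta> + u \<bullet> x) * e)"
  by (rule polynomial2_on_2I[where ?c00.0 = "\<alpha> * \<beta> * e" and ?c01.0 = "(\<alpha> * u $ 2 + \<beta> * v $ 2) * e"
        and ?c02.0 = "v $ 2 * u $ 2 * e" and ?c10.0 = "(\<alpha> * u $ 1 + \<beta> * v $ 1) * e"
        and ?c11.0 = "(v $ 1 * u $ 2 + v $ 2 * u $ 1) * e" and ?c20.0 = "v $ 1 * u $ 1 * e"])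
     (simp add: inner_vec_def sum_2 power2_eq_square algebra_simps)

text \<open>Substituting the affine coordinate functions for the weights turns
  \<open>p2_form\<close> into a polynomial on the whole plane, so continuity and degree need no
  reference to the triangle.\<close>

lemma p2_interpolant_triangle:
  fixes a b c :: "real^2" and f :: "real^2 \<Rightarrow> real^2"
  assumes nc: "\<not> collinear {a, b, c}"
  shows "\<exists>\<phi>. continuous_on UNIV \<phi> \<and> (\<forall>i S. polynomial2_on 2 S (\<lambda>x. \<phi> x $ i)) \<and>
    (\<forall>w. sum w {a, b, c} = 1 \<longrightarrow> \<phi> (\<Sum>p\<in>{a, b, c}. w p *\<^sub>R p) = p2_form f {a, b, c} w)"
proof -
  have dist: "a \<noteq> b" "a \<noteq> c" "b \<noteq> c" using nc by (auto simp: insert_commute)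
  \<comment> \<open>Each vertex in turn is moved to the first place, the one that
    \<open>barycentric_coordinate\<close> treats.\<close>
  have coord: "\<exists>\<alpha> v. \<forall>w. sum w {a, b, c} = 1 \<longrightarrow> \<alpha> + v \<bullet> (\<Sum>p\<in>{a, b, c}. w p *\<^sub>R p) = w q"
    if "q \<in> {a, b, c}" for q
  proof -
    have "\<exists>p2 p3. {a, b, c} = {q, p2, p3} \<and> q \<noteq> p2 \<and> q \<noteq> p3 \<and> p2 \<noteq> p3"
      using that dist by (elim insertE) auto
    then obtain p2 p3 where V: "{a, b, c} = {q, p2, p3}" and ne: "q \<noteq> p2" "q \<noteq> p3" "p2 \<noteq> p3" by blast
    obtain \<alpha> v where "\<And>w1 w2 w3. w1 + w2 + w3 = 1 \<Longrightarrow>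
        \<alpha> + v \<bullet> (w1 *\<^sub>R q + w2 *\<^sub>R p2 + w3 *\<^sub>R p3) = w1"
      using barycentric_coordinate[of q p2 p3] nc V by auto
    then show ?thesis unfolding V using ne by (intro exI[of _ \<alpha>] exI[of _ v]) (simp add: add.assoc)
  qed
  \<comment> \<open>The constant and the gradient are packed into a pair, so that one application of
    choice yields all coordinate functions.\<close>
  then have "\<forall>q\<in>{a, b, c}. \<exists>l. \<forall>w. sum w {a, b, c} = 1 \<longrightarrow>
      fst l + snd l \<bullet> (\<Sum>p\<in>{a, b, c}. w p *\<^sub>R p) = w q" by simp
  from bchoice[OF this] obtain l where l: "\<forall>q\<in>{a, b, c}. \<forall>w. sum w {a, b, c} = 1 \<longrightarrow>
      fst (l q) + snd (l q) \<bullet> (\<Sum>p\<in>{a, b, c}. w p *\<^sub>R p) = w q" ..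
  define \<phi> where "\<phi> = (\<lambda>x. p2_form f {a, b, c} (\<lambda>q. fst (l q) + snd (l q) \<bullet> x))"
  show ?thesis
  proof (intro exI[of _ \<phi>] conjI allI impI)
    show "continuous_on UNIV \<phi>" unfolding \<phi>_def p2_form_def by (intro continuous_intros)
    show "polynomial2_on 2 S (\<lambda>x. \<phi> x $ i)" for i S
      unfolding \<phi>_def p2_form_def sum_component vector_scaleR_component real_scaleR_def
      by (intro polynomial2_on_sum polynomial2_on_affine_mult)
    show "\<phi> (\<Sum>p\<in>{a, b, c}. w p *\<^sub>R p) = p2_form f {a, b, c} w" if "sum w {a, b, c} = 1" for w
      unfolding \<phi>_def p2_form_def using l that by (intro sum.cong refl) presburger
  qed
qed

section \<open>Closed triangles, their vertices and common faces\<close>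

lemma open_triangleE:
  assumes "open_triangle k"
  obtains a b c where "\<not> collinear {a, b, c}" "k = interior (convex hull {a, b, c})"
    "closure k = convex hull {a, b, c}" "{p. p extreme_point_of closure k} = {a, b, c}"
proof -
  obtain a b c where nc: "\<not> collinear {a, b, c}" and k: "k = interior (convex hull {a, b, c})"
    using assms unfolding open_triangle_def by blast
  have ai: "\<not> affine_dependent {a, b, c}"
    using nc by (metis collinear_3_eq_affine_dependent)
  \<comment> \<open>The centroid shows that the interior is nonempty, and the closure of a nonempty
    interior of a convex set recovers the closed set.\<close>
  have "(1/3) *\<^sub>R a + (1/3) *\<^sub>R b + (1/3) *\<^sub>R c \<in> interior (convex hull {a, b, c})"
    by (subst interior_convex_hull_3_minimal[OF nc]) (auto intro!: exI[of _ "1/3"])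
  then have "interior (convex hull {a, b, c}) \<noteq> {}" by blast
  then have cl: "closure k = convex hull {a, b, c}"
    unfolding k by (subst convex_closure_interior)
      (auto intro: closure_closed compact_imp_closed finite_imp_compact_convex_hull)
  show ?thesis
    by (rule that[OF nc k cl]) (auto simp: cl extreme_point_of_convex_hull_affine_independent[OF ai])
qed

text \<open>The intersection is compact and convex, hence the hull of its extreme points, and these
  are vertices of both triangles because it is a face of both. One set of weights on them, extended
  by zero, represents the point in either triangle.\<close>

lemma p2_form_agree_on_common_face:
  assumes k: "open_triangle k" and l: "open_triangle l"
    and face: "closure k \<inter> closure l face_of closure k" "closure k \<inter> closure l face_of closure l"
    and x: "x \<in> closure k" "x \<in> closure l"
  obtains w w' where "sum w {p. p extreme_point_of closure k} = 1"
    "(\<Sum>p | p extreme_point_of closure k. w p *\<^sub>R p) = x"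
    "sum w' {p. p extreme_point_of closure l} = 1"
    "(\<Sum>p | p extreme_point_of closure l. w' p *\<^sub>R p) = x"
    "p2_form f {p. p extreme_point_of closure k} w = p2_form f {p. p extreme_point_of closure l} w'"
proof -
  define G E where "G = closure k \<inter> closure l" and "E = {p. p extreme_point_of G}"
  have hull: "closure k' = convex hull {p. p extreme_point_of closure k'}"
      "finite {p. p extreme_point_of closure k'}" "compact (closure k')" "convex (closure k')"
    if tri: "open_triangle k'" for k'
  proof -
    obtain a b c where "\<not> collinear {a, b, c}" "k' = interior (convex hull {a, b, c})"
        and abc: "closure k' = convex hull {a, b, c}" "{p. p extreme_point_of closure k'} = {a, b, c}"
      using open_triangleE[OF tri] .
    show "closure k' = convex hull {p. p extreme_point_of closure k'}" unfolding abc(2) by (rule abc(1))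
    show "finite {p. p extreme_point_of closure k'}" unfolding abc(2) by simp
    show "compact (closure k')" by (simp add: abc(1) finite_imp_compact_convex_hull)
    show "convex (closure k')" by (simp add: abc(1))
  qed
  have "compact G" "convex G"
    unfolding G_def using hull[OF k] hull[OF l] by (auto intro: compact_Int convex_Int)
  then have G: "G = convex hull E" unfolding E_def by (rule Krein_Milman_Minkowski)
  have Ek: "E \<subseteq> {p. p extreme_point_of closure k}" and El: "E \<subseteq> {p. p extreme_point_of closure l}"
    unfolding E_def G_def using face extreme_point_of_face by blast+
  have finE: "finite E" using Ek hull(2)[OF k] finite_subset by blast
  have "x \<in> convex hull E" using x G by (auto simp: G_def)
  then obtain u where u: "sum u E = 1" "(\<Sum>p\<in>E. u p *\<^sub>R p) = x"
    unfolding convex_hull_finite[OF finE] by blast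
  define w where "w = (\<lambda>p. if p \<in> E then u p else 0)"
  have uE: "sum w E = 1" "(\<Sum>p\<in>E. w p *\<^sub>R p) = x"
    using u by (simp_all add: w_def cong: sum.cong)
  have ext: "sum w V = 1 \<and> (\<Sum>p\<in>V. w p *\<^sub>R p) = x \<and> p2_form f V w = p2_form f E w"
    if "finite V" "E \<subseteq> V" for V
  proof (intro conjI)
    have "sum w V = sum w E" by (rule sum.mono_neutral_right) (use that in \<open>auto simp: w_def\<close>)
    then show "sum w V = 1" using uE by simp
    have "(\<Sum>p\<in>V. w p *\<^sub>R p) = (\<Sum>p\<in>E. w p *\<^sub>R p)"
      by (rule sum.mono_neutral_right) (use that in \<open>auto simp: w_def\<close>)
    then show "(\<Sum>p\<in>V. w p *\<^sub>R p) = x" using uE by simp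
    show "p2_form f V w = p2_form f E w" by (rule p2_form_mono_neutral[OF that]) (simp add: w_def)
  qed
  show ?thesis
    using that[of w w] ext[OF hull(2)[OF k] Ek] ext[OF hull(2)[OF l] El] by simp
qed

text \<open>The polynomials of the single triangles agree wherever closed triangles meet, so they
  glue to a function on the closure of the domain.\<close>

lemma p2_interpolant_exists:
  fixes f :: "real^2 \<Rightarrow> real^2"
  assumes "regular_partition R T"
  obtains v where "v \<in> S_vec_space 2 R T" "\<And>p. p \<in> P2_nodes T \<Longrightarrow> v p = f p"
proof -
  have fin: "finite T" and tri: "\<And>k. k \<in> T \<Longrightarrow> open_triangle k" and cov: "(\<Union>k\<in>T. closure k) = closure R"
    and face: "\<And>k l. k \<in> T \<Longrightarrow> l \<in> T \<Longrightarrow> (closure k \<inter> closure l) face_of closure k"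
    using assms unfolding regular_partition_def by auto
  define V where "V = (\<lambda>k :: (real^2) set. {p. p extreme_point_of closure k})"
  have "\<forall>k\<in>T. \<exists>\<phi>. continuous_on UNIV \<phi> \<and> (\<forall>i S. polynomial2_on 2 S (\<lambda>x. \<phi> x $ i)) \<and>
      (\<forall>w. sum w (V k) = 1 \<longrightarrow> \<phi> (\<Sum>p\<in>V k. w p *\<^sub>R p) = p2_form f (V k) w)"
  proof
    fix k assume k: "k \<in> T"
    obtain a b c where nc: "\<not> collinear {a, b, c}" and "k = interior (convex hull {a, b, c})"
        "closure k = convex hull {a, b, c}" and V: "V k = {a, b, c}"
      using open_triangleE[OF tri[OF k]] unfolding V_def .
    show "\<exists>\<phi>. continuous_on UNIV \<phi> \<and> (\<forall>i S. polynomial2_on 2 S (\<lambda>x. \<phi> x $ i)) \<and>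
      (\<forall>w. sum w (V k) = 1 \<longrightarrow> \<phi> (\<Sum>p\<in>V k. w p *\<^sub>R p) = p2_form f (V k) w)"
      unfolding V by (rule p2_interpolant_triangle[OF nc])
  qed
  from bchoice[OF this] obtain \<phi> where \<phi>: "\<forall>k\<in>T. continuous_on UNIV (\<phi> k) \<and>
      (\<forall>i S. polynomial2_on 2 S (\<lambda>x. \<phi> k x $ i)) \<and>
      (\<forall>w. sum w (V k) = 1 \<longrightarrow> \<phi> k (\<Sum>p\<in>V k. w p *\<^sub>R p) = p2_form f (V k) w)" ..
  have cont: "continuous_on UNIV (\<phi> k)" if "k \<in> T" for k
    using \<phi> that by simp
  have poly: "polynomial2_on 2 S (\<lambda>x. \<phi> k x $ i)" if "k \<in> T" for k i S
    using \<phi> that by simp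
  have val: "\<phi> k (\<Sum>p\<in>V k. w p *\<^sub>R p) = p2_form f (V k) w" if "k \<in> T" "sum w (V k) = 1" for k w
    using \<phi> that by simp
  have agree: "\<phi> k x = \<phi> l x"
    if kl: "k \<in> T" "l \<in> T" and x: "x \<in> closure k" "x \<in> closure l" for k l x
  proof -
    have "closure k \<inter> closure l face_of closure l" using face[OF kl(2,1)] by (simp add: Int_commute)
    from p2_form_agree_on_common_face[OF tri[OF kl(1)] tri[OF kl(2)] face[OF kl] this x, of f]
    obtain w w' where "sum w (V k) = 1" "(\<Sum>p\<in>V k. w p *\<^sub>R p) = x"
      "sum w' (V l) = 1" "(\<Sum>p\<in>V l. w' p *\<^sub>R p) = x" "p2_form f (V k) w = p2_form f (V l) w'"
      unfolding V_def .
    then show ?thesis using val[OF kl(1), of w] val[OF kl(2), of w'] by simp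
  qed
  \<comment> \<open>The choice among several closed triangles containing a point is harmless by
    \<open>agree\<close>.\<close>
  define v where "v = (\<lambda>x. \<phi> (SOME k. k \<in> T \<and> x \<in> closure k) x)"
  have v: "v x = \<phi> k x" if "k \<in> T" "x \<in> closure k" for k x
  proof -
    have "(SOME k. k \<in> T \<and> x \<in> closure k) \<in> T \<and> x \<in> closure (SOME k. k \<in> T \<and> x \<in> closure k)"
      using someI[of "\<lambda>k. k \<in> T \<and> x \<in> closure k" k] that by blast
    then show ?thesis unfolding v_def using that by (intro agree) auto
  qed
  show ?thesis
  proof
    have cv: "continuous_on (closure R) v"
      unfolding cov[symmetric]
    \<comment> \<open>Pasting over finitely many closed sets.\<close>
    proof (rule continuous_on_closed_Union[OF fin])
      fix k assume k: "k \<in> T"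
      show "continuous_on (closure k) v"
        using continuous_on_cong[of "closure k" "closure k" v "\<phi> k"] v[OF k]
          continuous_on_subset[OF cont[OF k], of "closure k"] by simp
    qed simp
    have pv: "polynomial2_on 2 k (\<lambda>x. v x $ i)" if "k \<in> T" for k i
    proof -
      have "v x = \<phi> k x" if "x \<in> k" for x
        using v[OF \<open>k \<in> T\<close>] subsetD[OF closure_subset that] by simp
      then show ?thesis using poly[OF that, of k i] by (simp add: polynomial2_on_def)
    qed
    show "v \<in> S_vec_space 2 R T"
      unfolding S_vec_space_def S_space_def using continuous_on_component[OF cv] pv by simp
    show "v p = f p" if node: "p \<in> P2_nodes T" for p
    proof -
      obtain a b k where p: "p = midpoint a b" and k: "k \<in> T" and ab: "a \<in> V k" "b \<in> V k"
        using node unfolding P2_nodes_def V_def by blast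
      obtain a' b' c' where "\<not> collinear {a', b', c'}" "k = interior (convex hull {a', b', c'})"
        and abc: "closure k = convex hull {a', b', c'}" "V k = {a', b', c'}"
        using open_triangleE[OF tri[OF k]] unfolding V_def .
      have "midpoint a b \<in> convex hull (V k)"
        using closed_segment_subset_convex_hull[OF hull_inc[OF ab(1)] hull_inc[OF ab(2)]]
        by (meson midpoint_in_closed_segment subsetD)
      then have "p \<in> closure k" using abc p by simp
      moreover obtain w where "sum w (V k) = 1" "(\<Sum>x\<in>V k. w x *\<^sub>R x) = p" "p2_form f (V k) w = f p"
        unfolding p by (rule p2_form_midpoint[OF _ ab, of f]) (simp add: abc(2))
      ultimately show ?thesis using v[OF k] val[OF k, of w] by simp
    qed
  qed
qed

text \<open>The choice operator in \<open>I2\<close> tells nothing about its value until a witness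
  is known to exist.\<close>

lemma I2_in_S_vec_space:
  assumes "regular_partition R T"
  shows "I2 R T f \<in> S_vec_space 2 R T"
proof -
  have "\<exists>v. v \<in> S_vec_space 2 R T \<and> (\<forall>p\<in>P2_nodes T. v p = f p)"
    using p2_interpolant_exists[OF assms, of f] by metis
  from someI_ex[OF this] show ?thesis unfolding I2_def by (rule conjunct1)
qed

section \<open>Bounded measurable functions and the energy increments\<close>

text \<open>Unlike integrability, this is stable under pointwise products, and on a finite measure
  space it implies integrability. Thus every product in the energy balance is integrable by
  structural rules.\<close>

definition bounded_measurable :: "'a measure \<Rightarrow> ('a \<Rightarrow> 'b::euclidean_space) \<Rightarrow> bool" where
  "bounded_measurable M f \<longleftrightarrow> f \<in> borel_measurable M \<and> (\<exists>B. \<forall>x\<in>space M. norm (f x) \<le> B)"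

lemma bounded_measurable_const: "bounded_measurable M (\<lambda>_. c)"
  unfolding bounded_measurable_def by auto

lemma bounded_measurable_add:
  assumes "bounded_measurable M f" "bounded_measurable M g"
  shows "bounded_measurable M (\<lambda>x. f x + g x)"
  using assms unfolding bounded_measurable_def
  by (blast intro: borel_measurable_add norm_triangle_mono)

lemma bounded_measurable_scaleR:
  assumes "bounded_measurable M f" "bounded_measurable M g"
  shows "bounded_measurable M (\<lambda>x. f x *\<^sub>R g x)"
proof -
  obtain B C where "\<forall>x\<in>space M. norm (f x) \<le> B" "\<forall>x\<in>space M. norm (g x) \<le> C"
    using assms unfolding bounded_measurable_def by blast
  then have "\<forall>x\<in>space M. norm (f x *\<^sub>R g x) \<le> \<bar>B\<bar> * \<bar>C\<bar>"
    by (auto intro!: mult_mono)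
  then show ?thesis using assms unfolding bounded_measurable_def
    by (auto intro: borel_measurable_scaleR)
qed

lemma bounded_measurable_mult:
  fixes f g :: "'a \<Rightarrow> real"
  assumes "bounded_measurable M f" "bounded_measurable M g"
  shows "bounded_measurable M (\<lambda>x. f x * g x)"
  using bounded_measurable_scaleR[OF assms] by simp

lemma bounded_measurable_diff:
  assumes "bounded_measurable M f" "bounded_measurable M g"
  shows "bounded_measurable M (\<lambda>x. f x - g x)"
  using bounded_measurable_add[OF assms(1) bounded_measurable_scaleR[OF bounded_measurable_const[of M "-1"] assms(2)]]
  by simp

lemma bounded_measurable_inner:
  assumes "bounded_measurable M f" "bounded_measurable M g"
  shows "bounded_measurable M (\<lambda>x. f x \<bullet> g x)"
proof -
  obtain B C where "\<forall>x\<in>space M. norm (f x) \<le> B" "\<forall>x\<in>space M. norm (g x) \<le> C"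
    using assms unfolding bounded_measurable_def by blast
  then have "\<forall>x\<in>space M. norm (f x \<bullet> g x) \<le> \<bar>B\<bar> * \<bar>C\<bar>"
    by (auto intro!: order_trans[OF Cauchy_Schwarz_ineq2] mult_mono)
  then show ?thesis using assms unfolding bounded_measurable_def
    by (auto intro: borel_measurable_inner)
qed

lemma bounded_measurable_norm:
  assumes "bounded_measurable M f"
  shows "bounded_measurable M (\<lambda>x. norm (f x))"
  using assms unfolding bounded_measurable_def by auto

lemma bounded_measurable_component:
  fixes f :: "'a \<Rightarrow> real^'n"
  assumes "bounded_measurable M f"
  shows "bounded_measurable M (\<lambda>x. f x $ i)"
  using bounded_measurable_inner[OF assms bounded_measurable_const[of M "axis i 1"]]
  by (simp add: inner_axis)

lemma bounded_measurable_sum: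
  assumes "\<And>i. i \<in> I \<Longrightarrow> bounded_measurable M (f i)"
  shows "bounded_measurable M (\<lambda>x. \<Sum>i\<in>I. f i x)"
  using assms
  by (induction I rule: infinite_finite_induct)
     (auto intro: bounded_measurable_const bounded_measurable_add)

lemmas bounded_measurable_intros =
  bounded_measurable_const bounded_measurable_add bounded_measurable_diff bounded_measurable_scaleR
  bounded_measurable_mult bounded_measurable_inner bounded_measurable_norm bounded_measurable_component

lemma bounded_measurable_integrable:
  assumes "finite_measure M" "bounded_measurable M f"
  shows "integrable M f"
  using assms finite_measure.integrable_const_bound[OF assms(1)]
  unfolding bounded_measurable_def by auto

text \<open>Continuity is demanded up to the closure, whose compactness supplies the bound.\<close>

lemma bounded_measurable_continuous:
  fixes f :: "'a::euclidean_space \<Rightarrow> 'b::euclidean_space"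
  assumes "continuous_on (closure S) f" "bounded S" "S \<in> sets lebesgue"
  shows "bounded_measurable (lebesgue_on S) f"
proof -
  have "bounded (f ` closure S)"
    using assms by (intro compact_imp_bounded compact_continuous_image) (auto simp: compact_closure)
  then obtain B where "\<forall>x\<in>closure S. norm (f x) \<le> B" unfolding bounded_iff by auto
  moreover have "f \<in> borel_measurable (lebesgue_on S)"
    using assms closure_subset continuous_on_subset
    by (intro continuous_imp_measurable_on_sets_lebesgue) blast+
  ultimately show ?thesis
    unfolding bounded_measurable_def using closure_subset[of S] by (auto simp: space_restrict_space)
qed

lemma bounded_measurable_indicator:
  assumes "A \<in> sets lebesgue"
  shows "bounded_measurable (lebesgue_on S) (\<lambda>x. indicator A x :: real)"
proof -
  have "(\<lambda>x. indicator A x :: real) \<in> borel_measurable lebesgue"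
    using assms by (intro borel_measurable_indicator)
  from measurable_restrict_space1[OF this, of S] show ?thesis
    unfolding bounded_measurable_def by (intro conjI exI[of _ 1]) simp_all
qed

lemma bounded_measurable_piecewise_constant:
  fixes f :: "'a::euclidean_space \<Rightarrow> 'b::euclidean_space"
  assumes "finite C" "S \<in> sets lebesgue" "S \<subseteq> \<Union>C"
    and C: "\<And>c. c \<in> C \<Longrightarrow> c \<in> sets lebesgue" "\<And>c. c \<in> C \<Longrightarrow> \<exists>y. \<forall>x\<in>c \<inter> S. f x = y"
  shows "bounded_measurable (lebesgue_on S) f"
proof -
  obtain y where y: "\<And>c x. c \<in> C \<Longrightarrow> x \<in> c \<Longrightarrow> x \<in> S \<Longrightarrow> f x = y c"
    using C(2) by (metis IntI)
  have "f \<in> borel_measurable (lebesgue_on S)"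
  proof (rule measurable_piecewise_restrict[of C])
    show "countable C" using assms by (simp add: countable_finite)
    fix c assume c: "c \<in> C"
    show "c \<inter> space (lebesgue_on S) \<in> sets (lebesgue_on S)"
      using C(1)[OF c] assms(2) by (auto simp: sets_restrict_space)
    show "f \<in> borel_measurable (restrict_space (lebesgue_on S) c)"
      by (subst measurable_cong[where g = "\<lambda>_. y c"]) (auto simp: space_restrict_space y[OF c])
  qed (use assms in \<open>auto simp: space_restrict_space\<close>)
  \<comment> \<open>The sum of the finitely many values bounds each of them.\<close>
  moreover have "norm (f x) \<le> (\<Sum>c\<in>C. norm (y c))" if x: "x \<in> S" for x
  proof -
    obtain c where "c \<in> C" "x \<in> c" using x assms(3) by blast
    then show ?thesis using y x member_le_sum[of c C "\<lambda>c. norm (y c)"] assms(1) by simp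
  qed
  ultimately show ?thesis unfolding bounded_measurable_def by (auto simp: space_restrict_space)
qed

section \<open>Elementary rules for the inner product\<close>

lemma l2_inner_lebesgue_on:
  assumes "S \<in> sets lebesgue"
  shows "l2_inner S f g = (\<integral>x. f x \<bullet> g x \<partial>lebesgue_on S)"
  unfolding l2_inner_def set_lebesgue_integral_def
  using assms by (subst integral_restrict_space) auto

text \<open>Only the pointwise product matters, so scalar weights may be moved from one factor to
  the other.\<close>

lemma l2_inner_cong:
  assumes "\<And>x. x \<in> S \<Longrightarrow> f x \<bullet> g x = f' x \<bullet> g' x"
  shows "l2_inner S f g = l2_inner S f' g'"
  unfolding l2_inner_def set_lebesgue_integral_def
  by (rule Bochner_Integration.integral_cong) (auto simp: indicator_def assms)

lemma l2_inner_nonneg: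
  assumes "\<And>x. x \<in> S \<Longrightarrow> 0 \<le> f x \<bullet> g x"
  shows "0 \<le> l2_inner S f g"
  unfolding l2_inner_def set_lebesgue_integral_def
  by (rule Bochner_Integration.integral_nonneg) (auto simp: indicator_def assms)

text \<open>Pointwise the two sides differ by \<open>r\<close> times
  \<open>\<rho>0 |u - u0|\<^sup>2\<close>, where \<open>r = x $ 1\<close>. This numerical
  dissipation is nonnegative and is discarded.\<close>

lemma kinetic_energy_increment:
  fixes u u0 :: "real^2 \<Rightarrow> real^2" and \<rho> \<rho>0 :: "real^2 \<Rightarrow> real"
  assumes R: "bounded R" "R \<in> sets lebesgue" "\<And>x. x \<in> R \<Longrightarrow> 0 \<le> x $ 1"
    and bm: "bounded_measurable (lebesgue_on R) u" "bounded_measurable (lebesgue_on R) u0"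
      "bounded_measurable (lebesgue_on R) \<rho>" "bounded_measurable (lebesgue_on R) \<rho>0"
    and "\<And>x. 0 \<le> \<rho>0 x" "0 < dt"
  shows "l2_inner R (\<lambda>x. \<rho> x * (norm (u x))\<^sup>2) (\<lambda>x. x $ 1)
       - l2_inner R (\<lambda>x. \<rho>0 x * (norm (u0 x))\<^sup>2) (\<lambda>x. x $ 1)
     \<le> dt * (l2_inner R (\<lambda>x. (\<rho> x *\<^sub>R u x - \<rho>0 x *\<^sub>R u0 x) /\<^sub>R dt) (\<lambda>x. x $ 1 *\<^sub>R u x)
           + l2_inner R (\<lambda>x. \<rho>0 x *\<^sub>R ((u x - u0 x) /\<^sub>R dt)) (\<lambda>x. x $ 1 *\<^sub>R u x))"
proof -
  have fm: "finite_measure (lebesgue_on R)"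
    using R by (intro finite_measure_lebesgue_on bounded_set_imp_lmeasurable)
  have r: "bounded_measurable (lebesgue_on R) (\<lambda>x. x $ 1)"
    using R by (intro bounded_measurable_continuous continuous_intros)
  note int = bounded_measurable_integrable[OF fm]
  note bmi = bounded_measurable_intros bm r
  have "0 \<le> x $ 1 * (\<rho>0 x * (norm (u x - u0 x))\<^sup>2)" if "x \<in> R" for x
    using R(3)[OF that] assms(8) by simp
  moreover have "dt * (((\<rho> x *\<^sub>R u x - \<rho>0 x *\<^sub>R u0 x) /\<^sub>R dt) \<bullet> (x $ 1 *\<^sub>R u x)
      + (\<rho>0 x *\<^sub>R ((u x - u0 x) /\<^sub>R dt)) \<bullet> (x $ 1 *\<^sub>R u x))
      = ((\<rho> x * (norm (u x))\<^sup>2) \<bullet> x $ 1 - (\<rho>0 x * (norm (u0 x))\<^sup>2) \<bullet> x $ 1)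
        + x $ 1 * (\<rho>0 x * (norm (u x - u0 x))\<^sup>2)" for x
    using \<open>0 < dt\<close>
    by (simp add: power2_norm_eq_inner inner_diff_left inner_diff_right inner_commute[of "u x" "u0 x"] field_simps)
  ultimately have le: "(\<rho> x * (norm (u x))\<^sup>2) \<bullet> x $ 1 - (\<rho>0 x * (norm (u0 x))\<^sup>2) \<bullet> x $ 1
      \<le> dt * (((\<rho> x *\<^sub>R u x - \<rho>0 x *\<^sub>R u0 x) /\<^sub>R dt) \<bullet> (x $ 1 *\<^sub>R u x)
      + (\<rho>0 x *\<^sub>R ((u x - u0 x) /\<^sub>R dt)) \<bullet> (x $ 1 *\<^sub>R u x))" if "x \<in> R" for x
    using that by simp
  have i1: "integrable (lebesgue_on R) (\<lambda>x. (\<rho> x * (norm (u x))\<^sup>2) \<bullet> x $ 1)"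
    unfolding power2_eq_square by (intro int bmi)
  have i2: "integrable (lebesgue_on R) (\<lambda>x. (\<rho>0 x * (norm (u0 x))\<^sup>2) \<bullet> x $ 1)"
    unfolding power2_eq_square by (intro int bmi)
  have i3: "integrable (lebesgue_on R) (\<lambda>x. ((\<rho> x *\<^sub>R u x - \<rho>0 x *\<^sub>R u0 x) /\<^sub>R dt) \<bullet> (x $ 1 *\<^sub>R u x))"
    by (intro int bmi)
  have i4: "integrable (lebesgue_on R) (\<lambda>x. (\<rho>0 x *\<^sub>R ((u x - u0 x) /\<^sub>R dt)) \<bullet> (x $ 1 *\<^sub>R u x))"
    by (intro int bmi)
  show ?thesis
    unfolding l2_inner_lebesgue_on[OF R(2)]
    \<comment> \<open>Each side is collected into one integral, which needs the integrability of all
      four terms; then the pointwise inequality is integrated.\<close>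
    unfolding Bochner_Integration.integral_diff[OF i1 i2, symmetric]
      Bochner_Integration.integral_add[OF i3 i4, symmetric] integral_mult_right_zero[symmetric]
    by (rule integral_mono)
       (use i1 i2 i3 i4 le in \<open>auto simp: space_restrict_space\<close>)
qed

section \<open>Piecewise affine curves and their derivatives\<close>

lemma Vh_piece:
  assumes "J \<ge> 1" "\<alpha> \<in> {0<..<1}" "\<alpha> \<notin> nodes_I J"
  obtains j where "j \<in> {1..J}" "\<alpha> \<in> {(real j - 1) / real J <..< real j / real J}"
proof
  \<comment> \<open>Rounding up gives the piece that is closed on the right; being off the nodes
    then makes the upper inequality strict.\<close>
  define j where "j = nat \<lceil>\<alpha> * real J\<rceil>"
  have pos: "0 < \<alpha> * real J" "\<alpha> * real J < real J" using assms by auto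
  have j: "real j - 1 < \<alpha> * real J" "\<alpha> * real J \<le> real j"
    unfolding j_def using pos by linarith+
  show jJ: "j \<in> {1..J}" using j pos by auto
  have "\<alpha> * real J \<noteq> real j"
  proof
    assume "\<alpha> * real J = real j"
    then have "\<alpha> = real j / real J" using assms by (simp add: field_simps)
    then show False using assms(3) jJ by (auto simp: nodes_I_def)
  qed
  then show "\<alpha> \<in> {(real j - 1) / real J <..< real j / real J}"
    using j assms by (auto simp: field_simps)
qed

text \<open>One vector \<open>b\<close> serves the whole open piece, so the derivative is constant
  there.\<close>

lemma Vh_has_vector_derivative:
  assumes "X \<in> Vh J" "j \<in> {1..J}"
  shows "\<exists>b. \<forall>\<alpha>\<in>{(real j - 1) / real J <..< real j / real J}. (X has_vector_derivative b) (at \<alpha>)"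
proof -
  obtain a b where ab: "\<And>\<alpha>. \<alpha> \<in> {(real j - 1) / real J .. real j / real J} \<Longrightarrow> X \<alpha> = a + \<alpha> *\<^sub>R b"
    using assms unfolding Vh_def by blast
  show ?thesis
  proof (intro exI ballI)
    fix \<alpha> assume \<alpha>: "\<alpha> \<in> {(real j - 1) / real J <..< real j / real J}"
    have "((\<lambda>\<alpha>. a + \<alpha> *\<^sub>R b) has_vector_derivative b) (at \<alpha>)"
      by (auto intro!: derivative_eq_intros)
    then show "(X has_vector_derivative b) (at \<alpha>)"
      by (rule has_vector_derivative_transform_within_open[OF _ _ \<alpha>]) (auto simp: ab)
  qed
qed

lemma Vh_differentiable:
  assumes "X \<in> Vh J" "J \<ge> 1" "\<alpha> \<in> {0<..<1}" "\<alpha> \<notin> nodes_I J"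
  shows "(X has_vector_derivative D\<alpha> X \<alpha>) (at \<alpha>)"
proof -
  obtain j where j: "j \<in> {1..J}" "\<alpha> \<in> {(real j - 1) / real J <..< real j / real J}"
    using Vh_piece[OF assms(2-4)] .
  show ?thesis
    unfolding D\<alpha>_def using Vh_has_vector_derivative[OF assms(1) j(1)] j(2)
    by (metis vector_derivative_at)
qed

lemma finite_nodes_I: "finite (nodes_I J)"
  unfolding nodes_I_def by simp

text \<open>At a node the derivative may fail to exist and \<open>D\<alpha>\<close> takes an
  unspecified value; treating each node as a singleton piece keeps the function piecewise constant.
  Where the derivative is zero, its inverse length is 0 by convention, so the inverse is bounded
  too.\<close>

lemma D\<alpha>_bounded_measurable:
  assumes "X \<in> Vh J" "J \<ge> 1"
  shows "bounded_measurable (lebesgue_on {0<..<1}) (D\<alpha> X)"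
    and "bounded_measurable (lebesgue_on {0<..<1}) (\<lambda>\<alpha>. inverse (norm (D\<alpha> X \<alpha>)))"
proof -
  define C where "C = (\<lambda>j. {(real j - 1) / real J <..< real j / real J}) ` {1..J}
    \<union> (\<lambda>a. {a}) ` nodes_I J"
  have fin: "finite C" unfolding C_def by (simp add: finite_nodes_I)
  have cov: "{0<..<1} \<subseteq> \<Union>C"
  proof
    fix \<alpha> :: real assume "\<alpha> \<in> {0<..<1}"
    then have "\<alpha> \<in> nodes_I J \<or> (\<exists>j\<in>{1..J}. \<alpha> \<in> {(real j - 1) / real J <..< real j / real J})"
      using Vh_piece[OF assms(2), of \<alpha>] by metis
    then show "\<alpha> \<in> \<Union>C" unfolding C_def by auto
  qed
  have meas: "c \<in> sets lebesgue" if "c \<in> C" for c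
    using that unfolding C_def by (elim UnE imageE) simp_all
  have const: "\<exists>y. \<forall>x\<in>c \<inter> {0<..<1}. D\<alpha> X x = y" if c: "c \<in> C" for c
  proof -
    consider j where "j \<in> {1..J}" "c = {(real j - 1) / real J <..< real j / real J}"
      | a where "c = {a}"
      using c unfolding C_def by blast
    then show ?thesis
    proof cases
      case 1
      obtain b where "\<forall>\<alpha>\<in>c. (X has_vector_derivative b) (at \<alpha>)"
        unfolding 1(2) using Vh_has_vector_derivative[OF assms(1) 1(1)] ..
      then show ?thesis unfolding D\<alpha>_def using vector_derivative_at by blast
    qed auto
  qed
  show "bounded_measurable (lebesgue_on {0<..<1}) (D\<alpha> X)"
    by (rule bounded_measurable_piecewise_constant[OF fin _ cov meas const]) simp_all
  have inv: "\<exists>y. \<forall>x\<in>c \<inter> {0<..<1}. inverse (norm (D\<alpha> X x)) = y" if c: "c \<in> C" for c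
  proof -
    obtain y where "\<forall>x\<in>c \<inter> {0<..<1}. D\<alpha> X x = y" using const[OF c] ..
    then show ?thesis by (intro exI[of _ "inverse (norm y)"]) simp
  qed
  show "bounded_measurable (lebesgue_on {0<..<1}) (\<lambda>\<alpha>. inverse (norm (D\<alpha> X \<alpha>)))"
    by (rule bounded_measurable_piecewise_constant[OF fin _ cov meas inv]) simp_all
qed

lemma Vh_diff:
  assumes "f \<in> Vh J" "g \<in> Vh J"
  shows "(\<lambda>x. f x - g x) \<in> Vh J"
  unfolding Vh_def
proof (intro CollectI conjI ballI)
  show "continuous_on {0..1} (\<lambda>x. f x - g x)"
    using assms by (auto simp: Vh_def intro: continuous_on_diff)
  fix j assume j: "j \<in> {1..J}"
  obtain a b where ab: "\<forall>\<alpha>\<in>{(real j - 1) / real J .. real j / real J}. f \<alpha> = a + \<alpha> *\<^sub>R b"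
    using assms(1) j unfolding Vh_def by blast
  obtain c d where cd: "\<forall>\<alpha>\<in>{(real j - 1) / real J .. real j / real J}. g \<alpha> = c + \<alpha> *\<^sub>R d"
    using assms(2) j unfolding Vh_def by blast
  show "\<exists>a b. \<forall>\<alpha>\<in>{(real j - 1) / real J .. real j / real J}. f \<alpha> - g \<alpha> = a + \<alpha> *\<^sub>R b"
    using ab cd by (intro exI[of _ "a - c"] exI[of _ "b - d"]) (simp add: algebra_simps)
qed

section \<open>Increment of the surface energy\<close>

lemma length_increment_pointwise:
  fixes v v0 :: "'a::real_inner"
  assumes "0 \<le> r0" "v0 \<noteq> 0"
  shows "r * norm v - r0 * norm v0 \<le> (r - r0) * norm v + r0 * (inverse (norm v0) * (v \<bullet> (v - v0)))"
proof -
  \<comment> \<open>Cauchy-Schwarz reduces the claim to the nonnegativity of the square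
    \<open>(norm v - norm v0)\<^sup>2\<close>.\<close>
  have "norm v0 * (norm v - norm v0) \<le> v \<bullet> (v - v0)"
  proof -
    have "v \<bullet> v0 \<le> norm v * norm v0" by (rule norm_cauchy_schwarz)
    moreover have "0 \<le> (norm v - norm v0)\<^sup>2" by simp
    moreover have "v \<bullet> v = (norm v)\<^sup>2" by (simp add: power2_norm_eq_inner)
    ultimately show ?thesis by (simp add: inner_diff_right power2_eq_square algebra_simps)
  qed
  then have "norm v - norm v0 \<le> inverse (norm v0) * (v \<bullet> (v - v0))"
    using assms(2) by (simp add: field_simps)
  then have "r0 * (norm v - norm v0) \<le> r0 * (inverse (norm v0) * (v \<bullet> (v - v0)))"
    using assms(1) by (rule mult_left_mono)
  \<comment> \<open>The difference of products is split so that the change of radius meets the new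
    length \<open>norm v\<close>, just as in the curvature equation.\<close>
  then show ?thesis by (simp add: algebra_simps)
qed

text \<open>The right-hand side consists of the last two terms of the curvature equation, tested
  with the displacement of the curve.\<close>

lemma length_increment:
  fixes X X0 :: "real \<Rightarrow> real^2"
  assumes X: "X \<in> Vh J" "X0 \<in> Vh J" and J: "J \<ge> 1" and reg: "regular_curve J X0"
  shows "I_inner (\<lambda>\<alpha>. X \<alpha> $ 1) (\<lambda>\<alpha>. norm (D\<alpha> X \<alpha>)) - I_inner (\<lambda>\<alpha>. X0 \<alpha> $ 1) (\<lambda>\<alpha>. norm (D\<alpha> X0 \<alpha>))
    \<le> I_inner (\<lambda>\<alpha>. (X \<alpha> - X0 \<alpha>) $ 1) (\<lambda>\<alpha>. norm (D\<alpha> X \<alpha>))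
      + I_inner (\<lambda>\<alpha>. X0 \<alpha> $ 1 *\<^sub>R D\<alpha> X \<alpha>)
          (\<lambda>\<alpha>. inverse (norm (D\<alpha> X0 \<alpha>)) *\<^sub>R D\<alpha> (\<lambda>\<alpha>. X \<alpha> - X0 \<alpha>) \<alpha>)"
proof -
  let ?I = "lebesgue_on {0<..<1::real}"
  let ?\<eta> = "\<lambda>\<alpha>. X \<alpha> - X0 \<alpha>"
  have S: "{0<..<1::real} \<in> sets lebesgue" by simp
  have fm: "finite_measure ?I" by (intro finite_measure_lebesgue_on) simp
  have cont: "bounded_measurable ?I Y" if "Y \<in> Vh J" for Y :: "real \<Rightarrow> real^2"
    using that by (intro bounded_measurable_continuous) (auto simp: Vh_def)
  \<comment> \<open>The displacement enters as an element of \<open>Vh\<close> in its own right,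
    since at nodes \<open>D\<alpha>\<close> need not be additive.\<close>
  note bmi = bounded_measurable_intros cont[OF X(1)] cont[OF X(2)] D\<alpha>_bounded_measurable[OF X(1) J]
    D\<alpha>_bounded_measurable[OF X(2) J] D\<alpha>_bounded_measurable(1)[OF Vh_diff[OF X] J]
  note int = bounded_measurable_integrable[OF fm]
  have i1: "integrable ?I (\<lambda>\<alpha>. X \<alpha> $ 1 \<bullet> norm (D\<alpha> X \<alpha>))" by (intro int bmi)
  have i2: "integrable ?I (\<lambda>\<alpha>. X0 \<alpha> $ 1 \<bullet> norm (D\<alpha> X0 \<alpha>))" by (intro int bmi)
  have i3: "integrable ?I (\<lambda>\<alpha>. ?\<eta> \<alpha> $ 1 \<bullet> norm (D\<alpha> X \<alpha>))" by (intro int bmi)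
  have i4: "integrable ?I (\<lambda>\<alpha>. (X0 \<alpha> $ 1 *\<^sub>R D\<alpha> X \<alpha>) \<bullet> (inverse (norm (D\<alpha> X0 \<alpha>)) *\<^sub>R D\<alpha> ?\<eta> \<alpha>))"
    by (intro int bmi)
  \<comment> \<open>The nodes, where derivatives may be missing, are finitely many and hence null;
    the inequality is only claimed almost everywhere.\<close>
  have "negligible (nodes_I J)" by (simp add: finite_nodes_I negligible_finite)
  then have "AE \<alpha> in lebesgue. \<alpha> \<notin> nodes_I J"
    by (simp add: negligible_iff_null_sets AE_not_in)
  then have "AE \<alpha> in ?I. \<alpha> \<notin> nodes_I J"
    by (subst AE_restrict_space_iff) auto
  moreover have "AE \<alpha> in ?I. \<alpha> \<in> {0<..<1}"
    using AE_space[of ?I] by (simp add: space_restrict_space)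
  ultimately have le: "AE \<alpha> in ?I. X \<alpha> $ 1 \<bullet> norm (D\<alpha> X \<alpha>) - X0 \<alpha> $ 1 \<bullet> norm (D\<alpha> X0 \<alpha>)
      \<le> ?\<eta> \<alpha> $ 1 \<bullet> norm (D\<alpha> X \<alpha>) + (X0 \<alpha> $ 1 *\<^sub>R D\<alpha> X \<alpha>) \<bullet> (inverse (norm (D\<alpha> X0 \<alpha>)) *\<^sub>R D\<alpha> ?\<eta> \<alpha>)"
  proof eventually_elim
    case (elim \<alpha>)
    have "D\<alpha> ?\<eta> \<alpha> = D\<alpha> X \<alpha> - D\<alpha> X0 \<alpha>"
      unfolding D\<alpha>_def[of ?\<eta>]
      using Vh_differentiable[OF X(1) J elim(2,1)] Vh_differentiable[OF X(2) J elim(2,1)]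
      by (intro vector_derivative_at has_vector_derivative_diff)
    moreover have "0 \<le> X0 \<alpha> $ 1" "D\<alpha> X0 \<alpha> \<noteq> 0"
      using reg elim unfolding regular_curve_def by (auto intro: less_imp_le)
    ultimately show ?case
      using length_increment_pointwise[of "X0 \<alpha> $ 1" "D\<alpha> X0 \<alpha>" "X \<alpha> $ 1" "D\<alpha> X \<alpha>"]
      by (simp add: mult.left_commute[of "inverse _"])
  qed
  show ?thesis
    unfolding l2_inner_lebesgue_on[OF S]
    unfolding Bochner_Integration.integral_diff[OF i1 i2, symmetric]
      Bochner_Integration.integral_add[OF i3 i4, symmetric]
    by (rule integral_mono_AE) (use i1 i2 i3 i4 le in auto)
qed

section \<open>Differences in weighted Sobolev spaces\<close>

lemma smooth_differentiable: "smooth \<phi> \<Longrightarrow> \<phi> differentiable (at x)"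
  by (erule smooth.cases) blast

lemma smooth_directional_derivative:
  "smooth \<phi> \<Longrightarrow> b \<in> Basis \<Longrightarrow> smooth (\<lambda>x. frechet_derivative \<phi> (at x) b)"
  by (erule smooth.cases) blast

lemma smooth_continuous: "smooth \<phi> \<Longrightarrow> continuous_on S \<phi>"
  by (intro continuous_at_imp_continuous_on ballI differentiable_imp_continuous_within smooth_differentiable)

text \<open>On \<open>K\<close> the continuous factor is bounded, and off \<open>K\<close> the
  product vanishes, so integrability over \<open>K\<close> carries over to
  \<open>\<Omega>\<close>.\<close>

lemma set_integrable_mult_compact_support:
  fixes f h :: "'a::euclidean_space \<Rightarrow> real"
  assumes f: "set_integrable lebesgue K f" and K: "compact K" "K \<subseteq> \<Omega>"
    and h: "continuous_on UNIV h" "\<And>x. x \<notin> K \<Longrightarrow> h x = 0"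
  shows "set_integrable lebesgue \<Omega> (\<lambda>x. f x \<bullet> h x)"
proof -
  have "bounded (h ` K)"
    using K h(1) by (meson compact_continuous_image compact_imp_bounded continuous_on_subset subset_UNIV)
  then obtain B where B: "\<And>x. x \<in> K \<Longrightarrow> \<bar>h x\<bar> \<le> B" by (auto simp: bounded_iff)
  have meas: "h \<in> borel_measurable lebesgue"
    using h(1) by (simp add: borel_measurable_continuous_onI measurable_completion)
  have "integrable lebesgue (\<lambda>x. (indicator K x *\<^sub>R f x) * h x)"
  proof (rule Bochner_Integration.integrable_bound)
    show "integrable lebesgue (\<lambda>x. B * (indicator K x *\<^sub>R f x))"
      using f unfolding set_integrable_def by (intro integrable_mult_right)
    show "(\<lambda>x. (indicator K x *\<^sub>R f x) * h x) \<in> borel_measurable lebesgue"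
      using f meas unfolding set_integrable_def by (intro borel_measurable_times) auto
    have "norm ((indicator K x *\<^sub>R f x) * h x) \<le> norm (B * (indicator K x *\<^sub>R f x))" for x
      using B[of x] by (cases "x \<in> K")
        (auto simp: abs_mult mult.commute[of _ "\<bar>h x\<bar>"] intro!: mult_right_mono order_trans[OF _ abs_ge_self[of B]])
    then show "AE x in lebesgue. norm ((indicator K x *\<^sub>R f x) * h x) \<le> norm (B * (indicator K x *\<^sub>R f x))"
      by simp
  qed
  moreover have "(\<lambda>x. (indicator K x *\<^sub>R f x) * h x) = (\<lambda>x. indicator \<Omega> x *\<^sub>R (f x \<bullet> h x))"
    using h(2) K(2) by (auto simp: fun_eq_iff indicator_def)
  ultimately show ?thesis unfolding set_integrable_def by simp
qed

lemma test_function_support: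
  assumes "test_function \<Omega> \<phi>" "b \<in> Basis"
  shows "\<exists>K. compact K \<and> K \<subseteq> \<Omega> \<and> (\<forall>x. x \<notin> K \<longrightarrow> \<phi> x = 0 \<and> frechet_derivative \<phi> (at x) b = 0)"
proof -
  obtain K where K: "compact K" "K \<subseteq> \<Omega>" "\<And>x. x \<notin> K \<Longrightarrow> \<phi> x = 0"
    using assms(1) unfolding test_function_def by blast
  have "frechet_derivative \<phi> (at x) b = 0" if x: "x \<notin> K" for x
  proof -
    \<comment> \<open>The complement of a compact set is open, so the function is zero near
      \<open>x\<close> and the same \<open>K\<close> supports the derivative.\<close>
    have "(\<phi> has_derivative (\<lambda>_. 0)) (at x)"
    proof (rule has_derivative_transform_within_open)
      show "((\<lambda>_. 0) has_derivative (\<lambda>_. 0)) (at x)" by simp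
      show "open (- K)" using K(1) compact_imp_closed by blast
    qed (use x K(3) in auto)
    then show ?thesis using frechet_derivative_at by metis
  qed
  then show ?thesis using K by blast
qed

text \<open>Splitting the integrals requires integrability of each product; it follows from local
  integrability on the compact support of the test function.\<close>

lemma weak_derivative_diff:
  assumes f: "weak_derivative \<Omega> b f f'" and g: "weak_derivative \<Omega> b g g'" and b: "b \<in> Basis"
  shows "weak_derivative \<Omega> b (\<lambda>x. f x - g x) (\<lambda>x. f' x - g' x)"
  unfolding weak_derivative_def
proof (intro conjI allI impI)
  show "locally_integrable \<Omega> (\<lambda>x. f x - g x)" "locally_integrable \<Omega> (\<lambda>x. f' x - g' x)"
    using f g unfolding weak_derivative_def locally_integrable_def by auto
  fix \<phi> assume \<phi>: "test_function \<Omega> \<phi>"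
  obtain K where K: "compact K" "K \<subseteq> \<Omega>" "\<And>x. x \<notin> K \<Longrightarrow> \<phi> x = 0"
    "\<And>x. x \<notin> K \<Longrightarrow> frechet_derivative \<phi> (at x) b = 0"
    using test_function_support[OF \<phi> b] by blast
  have sm: "smooth \<phi>" using \<phi> unfolding test_function_def by blast
  have cont: "continuous_on UNIV \<phi>" "continuous_on UNIV (\<lambda>x. frechet_derivative \<phi> (at x) b)"
    using smooth_continuous sm smooth_directional_derivative[OF sm b] by blast+
  have diff: "l2_inner \<Omega> (\<lambda>x. p x - q x) h = l2_inner \<Omega> p h - l2_inner \<Omega> q h"
    if "locally_integrable \<Omega> p" "locally_integrable \<Omega> q" "continuous_on UNIV h" "\<And>x. x \<notin> K \<Longrightarrow> h x = 0"
    for p q h :: "'a \<Rightarrow> real"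
  proof -
    have "set_integrable lebesgue K p" "set_integrable lebesgue K q"
      using that K(1,2) unfolding locally_integrable_def by auto
    from this[THEN set_integrable_mult_compact_support, OF K(1,2) that(3,4)]
    have "set_integrable lebesgue \<Omega> (\<lambda>x. p x \<bullet> h x)" "set_integrable lebesgue \<Omega> (\<lambda>x. q x \<bullet> h x)"
      by blast+
    then show ?thesis unfolding l2_inner_def inner_diff_left by (rule set_integral_diff(2))
  qed
  show "l2_inner \<Omega> (\<lambda>x. f x - g x) (\<lambda>x. frechet_derivative \<phi> (at x) b)
      = - l2_inner \<Omega> (\<lambda>x. f' x - g' x) \<phi>"
    using f g \<phi> diff[OF _ _ cont(2) K(4), of f g] diff[OF _ _ cont(1) K(3), of f' g']
    unfolding weak_derivative_def by simp
qed

lemma L2_weighted_diff: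
  assumes f: "f \<in> L2_weighted \<Omega> w" and g: "g \<in> L2_weighted \<Omega> w"
    and w: "set_borel_measurable lebesgue \<Omega> w" "\<And>x. x \<in> \<Omega> \<Longrightarrow> 0 \<le> w x"
  shows "(\<lambda>x. f x - g x) \<in> L2_weighted \<Omega> w"
proof -
  let ?i = "\<lambda>x. indicator \<Omega> x :: real"
  have mf: "(\<lambda>x. ?i x *\<^sub>R f x) \<in> borel_measurable lebesgue"
    and mg: "(\<lambda>x. ?i x *\<^sub>R g x) \<in> borel_measurable lebesgue"
    and mw: "(\<lambda>x. ?i x *\<^sub>R w x) \<in> borel_measurable lebesgue"
    and jf: "integrable lebesgue (\<lambda>x. ?i x *\<^sub>R (w x * (f x)\<^sup>2))"
    and jg: "integrable lebesgue (\<lambda>x. ?i x *\<^sub>R (w x * (g x)\<^sup>2))"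
    using assms unfolding L2_weighted_def set_borel_measurable_def set_integrable_def by auto
  have "(\<lambda>x. ?i x *\<^sub>R (f x - g x)) \<in> borel_measurable lebesgue"
    using borel_measurable_diff[OF mf mg] by (simp add: algebra_simps)
  moreover have "integrable lebesgue (\<lambda>x. ?i x *\<^sub>R (w x * (f x - g x)\<^sup>2))"
  proof (rule Bochner_Integration.integrable_bound)
    show "integrable lebesgue (\<lambda>x. 2 * (?i x *\<^sub>R (w x * (f x)\<^sup>2)) + 2 * (?i x *\<^sub>R (w x * (g x)\<^sup>2)))"
      using jf jg by (intro Bochner_Integration.integrable_add integrable_mult_right)
    \<comment> \<open>Measurability is only known after cutting off to \<open>\<Omega>\<close>, so
      the integrand is rewritten with every factor cut off.\<close>
    have "(\<lambda>x. (?i x *\<^sub>R w x) * (?i x *\<^sub>R f x - ?i x *\<^sub>R g x)\<^sup>2) \<in> borel_measurable lebesgue"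
      using mf mg mw by measurable
    moreover have "(\<lambda>x. (?i x *\<^sub>R w x) * (?i x *\<^sub>R f x - ?i x *\<^sub>R g x)\<^sup>2)
        = (\<lambda>x. ?i x *\<^sub>R (w x * (f x - g x)\<^sup>2))"
      by (auto simp: indicator_def fun_eq_iff)
    ultimately show "(\<lambda>x. ?i x *\<^sub>R (w x * (f x - g x)\<^sup>2)) \<in> borel_measurable lebesgue" by simp
    have "norm (?i x *\<^sub>R (w x * (f x - g x)\<^sup>2))
        \<le> norm (2 * (?i x *\<^sub>R (w x * (f x)\<^sup>2)) + 2 * (?i x *\<^sub>R (w x * (g x)\<^sup>2)))" for x
    proof (cases "x \<in> \<Omega>")
      case True
      \<comment> \<open>This is the inequality
        \<open>(f - g)\<^sup>2 \<le> 2 f\<^sup>2 + 2 g\<^sup>2\<close> in disguise.\<close>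
      have "0 \<le> (f x + g x)\<^sup>2" by simp
      then have "(f x - g x)\<^sup>2 \<le> 2 * (f x)\<^sup>2 + 2 * (g x)\<^sup>2"
        by (simp add: power2_eq_square algebra_simps)
      from mult_left_mono[OF this w(2)[OF True]]
      have "w x * (f x - g x)\<^sup>2 \<le> 2 * (w x * (f x)\<^sup>2) + 2 * (w x * (g x)\<^sup>2)"
        by (simp add: algebra_simps)
      moreover have "0 \<le> w x * (f x - g x)\<^sup>2" using w(2)[OF True] by simp
      ultimately show ?thesis using True by simp
    qed simp
    then show "AE x in lebesgue. norm (?i x *\<^sub>R (w x * (f x - g x)\<^sup>2))
        \<le> norm (2 * (?i x *\<^sub>R (w x * (f x)\<^sup>2)) + 2 * (?i x *\<^sub>R (w x * (g x)\<^sup>2)))" by simp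
  qed
  ultimately show ?thesis
    unfolding L2_weighted_def set_borel_measurable_def set_integrable_def by simp
qed

lemma H1_weighted_diff:
  assumes f: "f \<in> H1_weighted \<Omega> w" and g: "g \<in> H1_weighted \<Omega> w"
    and w: "set_borel_measurable lebesgue \<Omega> w" "\<And>x. x \<in> \<Omega> \<Longrightarrow> 0 \<le> w x"
  shows "(\<lambda>x. f x - g x) \<in> H1_weighted \<Omega> w"
proof -
  have "\<exists>h\<in>L2_weighted \<Omega> w. weak_derivative \<Omega> b (\<lambda>x. f x - g x) h" if b: "b \<in> Basis" for b
  proof -
    obtain f' g' where "f' \<in> L2_weighted \<Omega> w" "weak_derivative \<Omega> b f f'"
      "g' \<in> L2_weighted \<Omega> w" "weak_derivative \<Omega> b g g'"
      using f g b unfolding H1_weighted_def by blast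
    then show ?thesis
      using weak_derivative_diff[OF _ _ b] L2_weighted_diff[OF _ _ w] by blast
  qed
  then show ?thesis
    using f g L2_weighted_diff[OF _ _ w] unfolding H1_weighted_def by simp
qed

text \<open>Needed for the displacement of the curve to be an admissible test function; the boundary
  values on the axis cancel.\<close>

lemma V_bdry_diff:
  assumes "X \<in> V_bdry" "Y \<in> V_bdry"
  shows "(\<lambda>\<alpha>. X \<alpha> - Y \<alpha>) \<in> V_bdry"
proof -
  have "set_borel_measurable lebesgue {0<..<1::real} (\<lambda>_. 1::real)"
    unfolding set_borel_measurable_def
    by (intro borel_measurable_scaleR borel_measurable_indicator borel_measurable_const) simp
  then have "(\<lambda>\<alpha>. X \<alpha> $ i - Y \<alpha> $ i) \<in> H1_weighted {0<..<1} (\<lambda>_. 1)" for i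
    using assms unfolding V_bdry_def by (intro H1_weighted_diff) auto
  then show ?thesis using assms unfolding V_bdry_def by (auto intro: continuous_on_diff)
qed

section \<open>The energy estimate\<close>

lemma triangle_lebesgue: "open_triangle k \<Longrightarrow> k \<in> sets lebesgue"
  unfolding open_triangle_def by (auto intro: borel_open lmeasurable_interior)

text \<open>An open set inside the closure lies in its interior, and the absence of slits identifies
  that interior with \<open>R\<close>.\<close>

lemma triangle_subset_domain:
  assumes "polygonal_domain R" "regular_partition R T" "k \<in> T"
  shows "k \<subseteq> R"
proof -
  have "open_triangle k" using assms unfolding regular_partition_def by blast
  then have "open k" unfolding open_triangle_def by auto
  moreover have "k \<subseteq> closure R"
    using assms closure_subset[of k] unfolding regular_partition_def by blast
  ultimately have "k \<subseteq> interior (closure R)" by (rule interior_maximal[rotated])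
  then show ?thesis using assms(1) unfolding polygonal_domain_def by simp
qed

lemma piecewise_constant_bounded_measurable:
  fixes c :: "(real^2) set \<Rightarrow> real"
  assumes "\<And>k. k \<in> T \<Longrightarrow> open_triangle k"
  shows "bounded_measurable (lebesgue_on R) (\<lambda>x. \<Sum>k\<in>T. indicator k x * c k)"
  using assms
  by (intro bounded_measurable_sum bounded_measurable_mult bounded_measurable_indicator
      bounded_measurable_const triangle_lebesgue)

lemma phase_coeff_bounded_measurable:
  assumes "regular_partition R T"
  shows "bounded_measurable (lebesgue_on R) (phase_coeff R T X cm cp)"
  unfolding phase_coeff_def[abs_def] using assms
  by (intro piecewise_constant_bounded_measurable) (auto simp: regular_partition_def)

text \<open>The inequality is weak because the coefficient is 0 at points outside all open
  triangles, such as edges.\<close>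

lemma phase_coeff_nonneg:
  assumes "0 \<le> cm" "0 \<le> cp"
  shows "0 \<le> phase_coeff R T X cm cp x"
  unfolding phase_coeff_def using assms by (intro sum_nonneg) auto

lemma I0_bounded_measurable:
  assumes "regular_partition R T"
  shows "bounded_measurable (lebesgue_on R) (I0 T f)"
  unfolding I0_def[abs_def] using assms
  by (intro piecewise_constant_bounded_measurable) (auto simp: regular_partition_def)

lemma I0_nonneg:
  assumes "\<And>x. 0 \<le> f x"
  shows "0 \<le> I0 T f x"
  unfolding I0_def set_lebesgue_integral_def using assms
  by (intro sum_nonneg mult_nonneg_nonneg divide_nonneg_nonneg Bochner_Integration.integral_nonneg) auto

lemma S_vec_space_bounded_measurable:
  assumes "v \<in> S_vec_space d R T" "bounded R" "R \<in> sets lebesgue"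
  shows "bounded_measurable (lebesgue_on R) v"
proof -
  have "continuous_on (closure R) (\<lambda>x. \<chi> i. v x $ i)"
    using assms(1) by (intro continuous_on_vec_lambda) (auto simp: S_vec_space_def S_space_def)
  then show ?thesis using assms(2,3) by (intro bounded_measurable_continuous) simp_all
qed

lemma Vh_bdry_diff:
  assumes "X \<in> Vh_bdry J" "Y \<in> Vh_bdry J"
  shows "(\<lambda>\<alpha>. X \<alpha> - Y \<alpha>) \<in> Vh_bdry J"
  using assms unfolding Vh_bdry_def by (auto intro: Vh_diff V_bdry_diff)

text \<open>This is the effect of the antisymmetric form of the advection: the integrand itself is
  zero for equal arguments.\<close>

lemma A_form_same: "A_form R \<rho> w u u = 0"
  unfolding A_form_def l2_inner_def by simp

text \<open>The square roots recombine because \<open>\<mu>\<close> and the radius are nonnegative,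
  also at the sampling points, which lie in triangles and hence in \<open>R\<close>. The integrands
  agree pointwise.\<close>

lemma dissipation_eq:
  assumes R: "\<And>x. x \<in> R \<Longrightarrow> 0 \<le> x $ 1" and \<mu>: "\<And>x. 0 \<le> \<mu> x"
    and quad: "interior_quadrature T pts wt" and T: "\<And>k. k \<in> T \<Longrightarrow> k \<subseteq> R"
  shows "dissipation R T pts wt \<mu> u = l2_inner R (\<lambda>x. \<mu> x *\<^sub>R D_c u x) (\<lambda>x. x $ 1 *\<^sub>R D_c u x)
    + quad_inner T pts wt (\<lambda>x. \<mu> x * inverse (x $ 1) * (u x $ 1)) (\<lambda>x. u x $ 1)"
proof -
  let ?f = "\<lambda>x. sqrt (\<mu> x * x $ 1) *\<^sub>R D_c u x"
  let ?q = "\<lambda>x. sqrt (\<mu> x * inverse (x $ 1)) * (u x $ 1)"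
  have "(l2_norm R ?f)\<^sup>2 = l2_inner R ?f ?f"
    unfolding l2_norm_def by (rule real_sqrt_pow2[OF l2_inner_nonneg]) (rule inner_ge_zero)
  also have "\<dots> = l2_inner R (\<lambda>x. \<mu> x *\<^sub>R D_c u x) (\<lambda>x. x $ 1 *\<^sub>R D_c u x)"
    by (rule l2_inner_cong) (simp add: R \<mu> flip: mult.assoc)
  finally have 1: "(l2_norm R ?f)\<^sup>2 = l2_inner R (\<lambda>x. \<mu> x *\<^sub>R D_c u x) (\<lambda>x. x $ 1 *\<^sub>R D_c u x)" .
  have pos: "0 \<le> p $ 1" "0 \<le> wt k p" if "k \<in> T" "p \<in> pts k" for k p
    using R T quad that unfolding interior_quadrature_def by blast+
  have "(quad_norm T pts wt ?q)\<^sup>2 = quad_inner T pts wt ?q ?q"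
    unfolding quad_norm_def
    by (rule real_sqrt_pow2) (simp add: quad_inner_def pos sum_nonneg)
  also have "\<dots> = quad_inner T pts wt (\<lambda>x. \<mu> x * inverse (x $ 1) * (u x $ 1)) (\<lambda>x. u x $ 1)"
    unfolding quad_inner_def
  proof (intro sum.cong refl)
    fix k p assume kp: "k \<in> T" "p \<in> pts k"
    have "sqrt (\<mu> p * inverse (p $ 1)) * sqrt (\<mu> p * inverse (p $ 1)) = \<mu> p * inverse (p $ 1)"
      using \<mu>[of p] pos(1)[OF kp] by (subst real_sqrt_mult_self) simp
    then have "?q p * ?q p = \<mu> p * inverse (p $ 1) * (u p $ 1) * u p $ 1"
      by (metis mult.assoc mult.left_commute)
    then show "wt k p * (?q p * ?q p) = wt k p * (\<mu> p * inverse (p $ 1) * (u p $ 1) * u p $ 1)"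
      by simp
  qed
  finally show ?thesis unfolding dissipation_def 1 by simp
qed

text \<open>One time step with the interpolated data kept abstract: about \<open>u0\<close> and
  \<open>\<rho>0\<close> only bounded measurability and \<open>\<rho>0 \<ge> 0\<close> are
  used.\<close>

lemma energy_step:
  assumes R: "polygonal_domain R" "\<forall>x\<in>R. x $ 1 > 0" and T: "regular_partition R T"
    and quad: "interior_quadrature T pts wt"
    and pos: "\<gamma> > 0" "dt > 0" "J \<ge> 1" "\<And>x. 0 \<le> \<mu> x" "\<And>x. 0 \<le> \<rho>0 x"
    and bm: "bounded_measurable (lebesgue_on R) \<rho>" "bounded_measurable (lebesgue_on R) \<rho>0"
      "bounded_measurable (lebesgue_on R) u0"
    and X0: "X0 \<in> Vh_bdry J" "regular_curve J X0"
    and sol: "scheme_solution R B1 B2 T PP J pts wt \<gamma> dt g \<rho>0 \<rho> \<mu> u0 X0 u p X \<kappa>"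
  shows "1 / (2 * pi) * energy R \<gamma> \<rho> u X + 2 * dt * dissipation R T pts wt \<mu> u
    \<le> 1 / (2 * pi) * energy R \<gamma> \<rho>0 u0 X0 + dt * l2_inner R (\<lambda>x. (\<rho> x * x $ 1) *\<^sub>R g x) u"
proof -
  have u: "u \<in> Uh_space R B1 B2 T" and p: "p \<in> PP" and X: "X \<in> Vh_bdry J" and \<kappa>: "\<kappa> \<in> Vh J"
    and mom: "momentum_eq R T pts wt \<gamma> dt g \<rho>0 \<rho> \<mu> u0 X0 u p \<kappa> u"
    and inc: "incompressibility_eq R u p"
    and kin: "kinematic_eq dt X0 u X \<kappa>"
    and curv: "curvature_eq X0 X \<kappa> (\<lambda>\<alpha>. X \<alpha> - X0 \<alpha>)"
    using sol Vh_bdry_diff[OF _ X0(1), of X] unfolding scheme_solution_def by blast+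
  have bounded: "bounded R" and leb: "R \<in> sets lebesgue"
    using R(1) unfolding polygonal_domain_def by auto
  have rpos: "0 \<le> x $ 1" if "x \<in> R" for x using R(2) that by (simp add: less_imp_le)
  have bmu: "bounded_measurable (lebesgue_on R) u"
    using u S_vec_space_bounded_measurable[OF _ bounded leb] unfolding Uh_space_def by blast
  let ?N = "\<lambda>\<alpha>. norm (D\<alpha> X0 \<alpha>)"
  define A B where
    "A = l2_inner R (\<lambda>x. (\<rho> x *\<^sub>R u x - \<rho>0 x *\<^sub>R u0 x) /\<^sub>R dt) (\<lambda>x. x $ 1 *\<^sub>R u x)" and
    "B = l2_inner R (\<lambda>x. \<rho>0 x *\<^sub>R ((u x - u0 x) /\<^sub>R dt)) (\<lambda>x. x $ 1 *\<^sub>R u x)"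
  define K K0 where "K = l2_inner R (\<lambda>x. \<rho> x * (norm (u x))\<^sup>2) (\<lambda>x. x $ 1)" and
    "K0 = l2_inner R (\<lambda>x. \<rho>0 x * (norm (u0 x))\<^sup>2) (\<lambda>x. x $ 1)"
  define L L0 where "L = I_inner (\<lambda>\<alpha>. X \<alpha> $ 1) (\<lambda>\<alpha>. norm (D\<alpha> X \<alpha>))" and
    "L0 = I_inner (\<lambda>\<alpha>. X0 \<alpha> $ 1) (\<lambda>\<alpha>. norm (D\<alpha> X0 \<alpha>))"
  define F where "F = l2_inner R (\<lambda>x. (\<rho> x * x $ 1) *\<^sub>R g x) u"
  define Y where "Y = I_inner (\<lambda>\<alpha>. (X0 \<alpha> $ 1 * \<kappa> \<alpha>) *\<^sub>R normal X0 \<alpha>) (\<lambda>\<alpha>. ?N \<alpha> *\<^sub>R u (X0 \<alpha>))"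
  have kinetic: "K - K0 \<le> dt * (A + B)"
    unfolding K_def K0_def A_def B_def
    by (rule kinetic_energy_increment[OF bounded leb rpos bmu bm(3,1,2) pos(5,2)])
  \<comment> \<open>The discrete pressure is itself an admissible multiplier, so the pressure work
    vanishes.\<close>
  have pressure: "l2_inner R p (div_c (\<lambda>x. x $ 1 *\<^sub>R u x)) = 0"
    using inc unfolding incompressibility_eq_def l2_inner_def by (simp add: mult.commute)
  have force: "l2_inner R (\<lambda>x. \<rho> x *\<^sub>R g x) (\<lambda>x. x $ 1 *\<^sub>R u x) = F"
    unfolding F_def by (rule l2_inner_cong) simp
  have "dissipation R T pts wt \<mu> u = l2_inner R (\<lambda>x. \<mu> x *\<^sub>R D_c u x) (\<lambda>x. x $ 1 *\<^sub>R D_c u x)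
      + quad_inner T pts wt (\<lambda>x. \<mu> x * inverse (x $ 1) * (u x $ 1)) (\<lambda>x. u x $ 1)"
    using rpos pos(4) quad triangle_subset_domain[OF R(1) T] by (rule dissipation_eq)
  then have "(1/2) * (A + B) + 2 * dissipation R T pts wt \<mu> u - \<gamma> * Y = F"
    using mom unfolding momentum_eq_def A_form_same pressure force
      A_def[symmetric] B_def[symmetric] Y_def[symmetric] by simp
  from arg_cong[OF this, of "\<lambda>s. dt * s"]
  have momentum: "(1/2) * (dt * (A + B)) + 2 * dt * dissipation R T pts wt \<mu> u - \<gamma> * (dt * Y) = dt * F"
    by (simp add: algebra_simps add_divide_distrib)
  define Z where "Z = I_inner (\<lambda>\<alpha>. (X0 \<alpha> $ 1 * \<kappa> \<alpha>) *\<^sub>R normal X0 \<alpha>) (\<lambda>\<alpha>. ?N \<alpha> *\<^sub>R (X \<alpha> - X0 \<alpha>))"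
  have "I_inner (\<lambda>\<alpha>. X0 \<alpha> $ 1 *\<^sub>R (X \<alpha> - X0 \<alpha>)) (\<lambda>\<alpha>. (\<kappa> \<alpha> * ?N \<alpha>) *\<^sub>R normal X0 \<alpha>) = Z"
    unfolding Z_def by (rule l2_inner_cong) (simp add: inner_commute)
  moreover have "I_inner (\<lambda>\<alpha>. X0 \<alpha> $ 1 *\<^sub>R u (X0 \<alpha>)) (\<lambda>\<alpha>. (\<kappa> \<alpha> * ?N \<alpha>) *\<^sub>R normal X0 \<alpha>) = Y"
    unfolding Y_def by (rule l2_inner_cong) (simp add: inner_commute)
  \<comment> \<open>The kinematic equation trades the velocity on the curve for the displacement, so
    the work of surface tension matches the first term of the curvature equation.\<close>
  ultimately have "dt * Y = Z"
    using kin pos(2) unfolding kinematic_eq_def by (simp add: field_simps)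
  moreover have "L - L0 \<le> - Z"
    using curv length_increment[of X J X0] X X0 pos(3)
    unfolding curvature_eq_def Z_def[symmetric] L_def L0_def Vh_bdry_def by simp
  ultimately have "\<gamma> * (L - L0) \<le> - (\<gamma> * (dt * Y))"
    using mult_left_mono[of "L - L0" "- Z" \<gamma>] pos(1) by simp
  \<comment> \<open>Dividing by \<open>2 * pi\<close> leaves the factor 1/2 that also stands before
    the time differences in the momentum equation, and \<open>\<gamma>\<close> before the length
    term.\<close>
  moreover have "1 / (2 * pi) * energy R \<gamma> \<rho> u X = K / 2 + \<gamma> * L"
    "1 / (2 * pi) * energy R \<gamma> \<rho>0 u0 X0 = K0 / 2 + \<gamma> * L0"
    unfolding energy_def K_def K0_def L_def L0_def by (simp_all add: field_simps)
  ultimately show ?thesis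
    using kinetic momentum unfolding F_def[symmetric] by (simp add: algebra_simps)
qed

theorem theorem1:
  fixes R B1 B2 :: "(real^2) set"
    and rho_minus rho_plus mu_minus mu_plus \<gamma> :: real
    and g :: "real^2 \<Rightarrow> real^2"
    and tmax dt :: real and M J :: nat
    and T :: "nat \<Rightarrow> (real^2) set set"
    and pts :: "nat \<Rightarrow> (real^2) set \<Rightarrow> (real^2) set"
    and wt :: "nat \<Rightarrow> (real^2) set \<Rightarrow> real^2 \<Rightarrow> real"
    and PP :: "nat \<Rightarrow> (real^2 \<Rightarrow> real) set"
    and \<rho> \<mu> :: "nat \<Rightarrow> real^2 \<Rightarrow> real"
    and U :: "nat \<Rightarrow> real^2 \<Rightarrow> real^2" and P :: "nat \<Rightarrow> real^2 \<Rightarrow> real"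
    and X :: "nat \<Rightarrow> real \<Rightarrow> real^2" and \<kappa> :: "nat \<Rightarrow> real \<Rightarrow> real"
    and solution :: "nat \<Rightarrow> bool"
  assumes "polygonal_domain R" and "\<forall>x\<in>R. x $ 1 > 0"
    and "frontier R = B1 \<union> B2 \<union> axis_boundary R"
    and "rho_minus > 0" "rho_plus > 0" "mu_minus > 0" "mu_plus > 0" "\<gamma> > 0"
    and "tmax > 0" "M \<ge> 1" "dt = tmax / real M" "J \<ge> 1"
    and "\<forall>m<M. regular_partition R (T m)"
    and "\<forall>m<M. interior_quadrature (T m) (pts m) (wt m)"
    and "\<forall>m\<le>M. X m \<in> Vh_bdry J \<and> regular_curve J (X m)"
    and "\<forall>m<M. divides_domain R J (X m)"
    and "\<forall>m<M. PP m = Ph_space R (T m) \<or> PP m = Ph_enriched R (T m) (X m)"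
    and "\<forall>m<M. \<rho> m = phase_coeff R (T m) (X m) rho_minus rho_plus"
    and "\<forall>m<M. \<mu> m = phase_coeff R (T m) (X m) mu_minus mu_plus"
    \<comment> \<open>Subtraction on \<open>nat\<close> truncates, so that for \<open>m = 0\<close> this is the condition on the initial
        velocity, and \<open>\<rho> (m - 1)\<close> follows the convention that \<open>\<rho>\<close> with index \<open>-1\<close> is \<open>\<rho> 0\<close>.\<close>
    and "\<forall>m<M. U m \<in> Uh_space R B1 B2 (T (m - 1))"
    and "solution = (\<lambda>m. scheme_solution R B1 B2 (T m) (PP m) J (pts m) (wt m) \<gamma> dt g
              (I0 (T m) (\<rho> (m - 1))) (\<rho> m) (\<mu> m) (I2 R (T m) (U m)) (X m)
              (U (Suc m)) (P (Suc m)) (X (Suc m)) (\<kappa> (Suc m)))"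
  shows "(\<forall>m<M. solution m \<longrightarrow>
           1 / (2 * pi) * energy R \<gamma> (\<rho> m) (U (Suc m)) (X (Suc m))
             + 2 * dt * dissipation R (T m) (pts m) (wt m) (\<mu> m) (U (Suc m))
           \<le> 1 / (2 * pi) * energy R \<gamma> (I0 (T m) (\<rho> (m - 1))) (I2 R (T m) (U m)) (X m)
             + dt * l2_inner R (\<lambda>x. (\<rho> m x * x $ 1) *\<^sub>R g x) (U (Suc m)))
       \<and> ((\<forall>m<M. solution m) \<and>
          (\<forall>m<M. energy R \<gamma> (I0 (T m) (\<rho> (m - 1))) (I2 R (T m) (U m)) (X m)
                  \<le> energy R \<gamma> (\<rho> (m - 1)) (U m) (X m)) \<longrightarrow>
         (\<forall>k<M.
           1 / (2 * pi) * energy R \<gamma> (\<rho> k) (U (Suc k)) (X (Suc k))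
             + 2 * dt * (\<Sum>m\<le>k. dissipation R (T m) (pts m) (wt m) (\<mu> m) (U (Suc m)))
           \<le> 1 / (2 * pi) * energy R \<gamma> (\<rho> 0) (U 0) (X 0)
             + dt * (\<Sum>m\<le>k. l2_inner R (\<lambda>x. (\<rho> m x * x $ 1) *\<^sub>R g x) (U (Suc m)))))"
proof -
  have dt: "dt > 0" using assms(9-11) by simp
  have density_nonneg: "0 \<le> \<rho> m x" and viscosity_nonneg: "0 \<le> \<mu> m x" if "m < M" for m x
    using assms(4-7,18,19) that by (simp_all add: phase_coeff_nonneg)
  have bounded: "bounded R" and leb: "R \<in> sets lebesgue"
    using assms(1) unfolding polygonal_domain_def by auto
  have step: "1 / (2 * pi) * energy R \<gamma> (\<rho> m) (U (Suc m)) (X (Suc m))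
      + 2 * dt * dissipation R (T m) (pts m) (wt m) (\<mu> m) (U (Suc m))
      \<le> 1 / (2 * pi) * energy R \<gamma> (I0 (T m) (\<rho> (m - 1))) (I2 R (T m) (U m)) (X m)
      + dt * l2_inner R (\<lambda>x. (\<rho> m x * x $ 1) *\<^sub>R g x) (U (Suc m))"
    if m: "m < M" and sol: "solution m" for m
  proof -
    have T: "regular_partition R (T m)" using assms(13) m by blast
    show ?thesis
    proof (rule energy_step[OF assms(1,2) T _ assms(8) dt assms(12)])
      show "interior_quadrature (T m) (pts m) (wt m)" using assms(14) m by blast
      show "0 \<le> \<mu> m x" for x using viscosity_nonneg m by blast
      \<comment> \<open>The index \<open>m - 1\<close> stays below \<open>M\<close>, also for
        \<open>m = 0\<close>, where it is 0 again.\<close>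
      show "0 \<le> I0 (T m) (\<rho> (m - 1)) x" for x
        using density_nonneg[of "m - 1"] m by (intro I0_nonneg) simp
      show "bounded_measurable (lebesgue_on R) (\<rho> m)"
        using assms(18) m by (simp add: phase_coeff_bounded_measurable[OF T])
      show "bounded_measurable (lebesgue_on R) (I0 (T m) (\<rho> (m - 1)))"
        by (rule I0_bounded_measurable[OF T])
      show "bounded_measurable (lebesgue_on R) (I2 R (T m) (U m))"
        by (rule S_vec_space_bounded_measurable[OF I2_in_S_vec_space[OF T] bounded leb])
      show "X m \<in> Vh_bdry J" "regular_curve J (X m)" using assms(15) m by auto
      show "scheme_solution R B1 B2 (T m) (PP m) J (pts m) (wt m) \<gamma> dt g
          (I0 (T m) (\<rho> (m - 1))) (\<rho> m) (\<mu> m) (I2 R (T m) (U m)) (X m)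
          (U (Suc m)) (P (Suc m)) (X (Suc m)) (\<kappa> (Suc m))"
        using sol unfolding assms(21) .
    qed
  qed
  have total: "1 / (2 * pi) * energy R \<gamma> (\<rho> k) (U (Suc k)) (X (Suc k))
      + 2 * dt * (\<Sum>m\<le>k. dissipation R (T m) (pts m) (wt m) (\<mu> m) (U (Suc m)))
      \<le> 1 / (2 * pi) * energy R \<gamma> (\<rho> 0) (U 0) (X 0)
      + dt * (\<Sum>m\<le>k. l2_inner R (\<lambda>x. (\<rho> m x * x $ 1) *\<^sub>R g x) (U (Suc m)))"
    if sol: "\<forall>m<M. solution m"
      and interp: "\<forall>m<M. energy R \<gamma> (I0 (T m) (\<rho> (m - 1))) (I2 R (T m) (U m)) (X m)
          \<le> energy R \<gamma> (\<rho> (m - 1)) (U m) (X m)"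
      and "k < M" for k
  proof -
    \<comment> \<open>The interpolation hypothesis replaces the interpolated energy by that of the
      previous step, so that the estimates telescope.\<close>
    have step': "1 / (2 * pi) * energy R \<gamma> (\<rho> m) (U (Suc m)) (X (Suc m))
        + 2 * dt * dissipation R (T m) (pts m) (wt m) (\<mu> m) (U (Suc m))
        \<le> 1 / (2 * pi) * energy R \<gamma> (\<rho> (m - 1)) (U m) (X m)
        + dt * l2_inner R (\<lambda>x. (\<rho> m x * x $ 1) *\<^sub>R g x) (U (Suc m))" if "m < M" for m
    proof -
      have "1 / (2 * pi) * energy R \<gamma> (I0 (T m) (\<rho> (m - 1))) (I2 R (T m) (U m)) (X m)
          \<le> 1 / (2 * pi) * energy R \<gamma> (\<rho> (m - 1)) (U m) (X m)"
        using interp that by (intro mult_left_mono) auto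
      then show ?thesis using step[OF that] sol that by fastforce
    qed
    show ?thesis
      using \<open>k < M\<close>
    proof (induction k)
      case 0
      \<comment> \<open>For \<open>m = 0\<close> the density \<open>\<rho> (0 - 1)\<close> is
        \<open>\<rho> 0\<close>, which gives the initial energy.\<close>
      then show ?case using step'[of 0] by simp
    next
      case (Suc k)
      \<comment> \<open>The energy on the right of the new step is the one bounded by the induction
        hypothesis, since \<open>Suc k - 1 = k\<close>.\<close>
      then show ?case using step'[of "Suc k"] by (simp add: distrib_left)
    qed
  qed
  show ?thesis using step total by blast
qed

end
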